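(* There are infinitely many primes that are $d$-translated unit sensitive for every nonnegative integer $d$. In fact, let $$A=124703827160493827160493827160493827160493827160493827035790$$ and $$B=41459060189171787548442999328384678040412832671445258454633.$$ Then there are infinitely many primes of the form $Am+B$, with $m$ a nonnegative integer, that are $[0,\infty)$-translated unit sensitive.
   Context: All digits are base 10. For a nonnegative integer $d$, a positive integer $n$ is called $d$-translated unit sensitive if appending $d$ zeros to the right of $n$ and then changing the unit digit to any possible unit digit $0,1,\dots,9$ results in a composite number, so long as the resulting number is not $n$ itself. Explicitly: for $d\ge 1$, this means $10^d n+j$ is composite for every $j\in\{0,1,\dots,9\}$; for $d=0$ (in which case $n$ is also called unit sensitive), it means $10\lfloor n/10\rfloor+j$ is composite for every $j\in\{0,1,\dots,9\}$ with $10\lfloor n/10\rfloor+j\ne n$. The integer $n$ is called $[0,\infty)$-translated unit sensitive if it is $d$-translated unit sensitive for every nonnegative integer $d$. *)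

theory Defs
  imports "HOL-Computational_Algebra.Primes"
begin

definition composite :: "nat \<Rightarrow> bool" where
  "composite n \<longleftrightarrow> n > 1 \<and> \<not> prime n"

definition translated_unit_sensitive :: "nat \<Rightarrow> nat \<Rightarrow> bool" where
  "translated_unit_sensitive d n \<longleftrightarrow> n > 0 \<and>
     (if d = 0
      then \<forall>j\<in>{0..9}. 10 * (n div 10) + j \<noteq> n \<longrightarrow> composite (10 * (n div 10) + j)
      else \<forall>j\<in>{0..9}. composite (10 ^ d * n + j))"

definition all_translated_unit_sensitive :: "nat \<Rightarrow> bool" where
  "all_translated_unit_sensitive n \<longleftrightarrow> (\<forall>d. translated_unit_sensitive d n)"

end

theory Submission
  imports Defs "HOL-Complex_Analysis.Complex_Analysis" "HOL-Number_Theory.Number_Theory"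
begin

text \<open>
  Every prime \<open>p = A m + B\<close> works: for suitable divisors \<open>q\<close> of \<open>A\<close>, the residue classes of
  \<open>d\<close> modulo the orders of 10 modulo \<open>q\<close> form covering systems, so that each \<open>10\<^sup>d p + j\<close> is
  divisible by one of the \<open>q\<close>. Infinitely many such primes exist by Dirichlet's theorem.

  The heart of Dirichlet's theorem is \<open>L(1, \<psi>) \<noteq> 0\<close> for nonprincipal \<open>\<psi>\<close>. Otherwise the
  product \<open>F\<close> of all \<open>c\<close> functions \<open>L(s, \<psi>)\<close> modulo \<open>N\<close> is holomorphic on \<open>Re s > 0\<close>. Put
  \<open>E(s) = L(c s, \<psi>\<^sub>0)\<close>. The Dirichlet series of \<open>- F'/F\<close> dominates that of \<open>- E'/E\<close>
  coefficientwise, because \<open>\<psi>(n\<^sup>c) = 1\<close> for all \<open>\<psi>\<close> and all \<open>n\<close> coprime to \<open>N\<close>. Hence, after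
  division by \<open>F(2)\<close> and \<open>E(2)\<close>, the Taylor coefficients of \<open>F\<close> in powers of \<open>2 - s\<close> dominate
  those of \<open>E\<close>, so \<open>F\<close> bounds \<open>E\<close> on \<open>(1/c, 2)\<close>, whereas \<open>E\<close> has a pole at \<open>1/c\<close>. Given the
  nonvanishing, \<open>(s - 1) \<Sum> \<psi>(n) \<Lambda>(n) n\<^sup>-\<^sup>s\<close> tends to 1 or 0 as \<open>s \<rightarrow> 1\<close> according to whether
  \<open>\<psi>\<close> is principal, and the orthogonality of characters isolates the progression.
\<close>

section \<open>Dirichlet characters\<close>

definition dchars :: "nat \<Rightarrow> (nat \<Rightarrow> complex) set" where
  "dchars N = {\<psi>. (\<forall>m n. \<psi> (m * n) = \<psi> m * \<psi> n) \<and> (\<forall>n. \<psi> (n + N) = \<psi> n) \<and>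
                  (\<forall>n. \<psi> n \<noteq> 0 \<longleftrightarrow> coprime n N)}"

definition principal_dchar :: "nat \<Rightarrow> nat \<Rightarrow> complex" where
  "principal_dchar N n = (if coprime n N then 1 else 0)"

lemma coprime_add_self_left: "coprime (n + N) N \<longleftrightarrow> coprime n (N :: nat)"
  by (metis coprime_iff_gcd_eq_1 gcd_add1)

lemma dchars_mult: "\<psi> \<in> dchars N \<Longrightarrow> \<psi> (m * n) = \<psi> m * \<psi> n"
  and dchars_periodic: "\<psi> \<in> dchars N \<Longrightarrow> \<psi> (n + N) = \<psi> n"
  and dchars_eq_0_iff: "\<psi> \<in> dchars N \<Longrightarrow> \<psi> n = 0 \<longleftrightarrow> \<not> coprime n N"
  by (auto simp: dchars_def)

lemma dchars_1: "\<psi> \<in> dchars N \<Longrightarrow> \<psi> 1 = 1"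
  using dchars_mult[of \<psi> N 1 1] dchars_eq_0_iff[of \<psi> N 1] by simp

lemma dchars_power: "\<psi> \<in> dchars N \<Longrightarrow> \<psi> (n ^ k) = \<psi> n ^ k"
  using dchars_1[of \<psi> N] by (induction k) (auto simp: dchars_mult)

lemma dchars_mod:
  assumes "\<psi> \<in> dchars N"
  shows "\<psi> (n mod N) = \<psi> n"
proof -
  have "\<psi> (m + k * N) = \<psi> m" for m k
  proof (induction k)
    case (Suc k)
    thus ?case using dchars_periodic[OF assms, of "m + k * N"] by (simp add: algebra_simps)
  qed simp
  from this[of "n mod N" "n div N"] show ?thesis by simp
qed

lemma dchars_cong: "\<psi> \<in> dchars N \<Longrightarrow> [m = n] (mod N) \<Longrightarrow> \<psi> m = \<psi> n"
  by (metis cong_def dchars_mod)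

text \<open>By Euler's theorem the values at units are roots of unity; both
  \<open>norm_dchars\<close> and the finiteness of \<open>dchars N\<close> rest on this.\<close>

lemma dchars_power_totient:
  assumes "\<psi> \<in> dchars N" "coprime n N"
  shows "\<psi> n ^ totient N = 1"
  using dchars_cong[OF assms(1) euler_theorem[OF assms(2)]] dchars_1[OF assms(1)]
  by (simp add: dchars_power[OF assms(1)])

lemma norm_dchars:
  assumes "\<psi> \<in> dchars N" "coprime n N" "N > 0"
  shows "norm (\<psi> n) = 1"
  using power_eq_1_iff[OF dchars_power_totient[OF assms(1,2)]] assms(3) by simp

lemma norm_dchars_le: "\<psi> \<in> dchars N \<Longrightarrow> N > 0 \<Longrightarrow> norm (\<psi> n) \<le> 1"
  using norm_dchars[of \<psi> N n] dchars_eq_0_iff[of \<psi> N n] by (cases "coprime n N") auto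

text \<open>A character is determined by its values on \<open>{..<N}\<close>, which lie in the
  finite set of 0 and the roots of unity of order dividing \<open>totient N\<close>.\<close>

lemma finite_dchars:
  assumes "N > 0"
  shows "finite (dchars N)"
proof (rule finite_subset)
  define V where "V = insert 0 {z::complex. z ^ totient N = 1}"
  show "dchars N \<subseteq> (\<lambda>f n. f (n mod N)) ` (PiE {..<N} (\<lambda>_. V))"
  proof
    fix \<psi> assume \<psi>: "\<psi> \<in> dchars N"
    have "\<psi> = (\<lambda>n. restrict \<psi> {..<N} (n mod N))"
      using assms by (simp add: fun_eq_iff dchars_mod[OF \<psi>])
    moreover have "\<psi> n \<in> V" for n
      using dchars_power_totient[OF \<psi>, of n] dchars_eq_0_iff[OF \<psi>, of n] by (auto simp: V_def)
    ultimately show "\<psi> \<in> (\<lambda>f n. f (n mod N)) ` (PiE {..<N} (\<lambda>_. V))"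
      by (intro image_eqI[of _ _ "restrict \<psi> {..<N}"]) auto
  qed
  have "totient N \<ge> 1" using assms by (simp add: Suc_le_eq)
  thus "finite ((\<lambda>f n. f (n mod N)) ` (PiE {..<N} (\<lambda>_. V)))"
    unfolding V_def using finite_roots_unity[of "totient N"] by (intro finite_imageI finite_PiE) auto
qed

lemma principal_dchar_in_dchars: "principal_dchar N \<in> dchars N"
  by (auto simp: dchars_def principal_dchar_def coprime_add_self_left)

lemma dchars_times: "\<psi> \<in> dchars N \<Longrightarrow> \<phi> \<in> dchars N \<Longrightarrow> (\<lambda>n. \<psi> n * \<phi> n) \<in> dchars N"
  by (auto simp: dchars_def)

text \<open>An injective self-map of a finite set is bijective, so no inverse character has to be
  constructed. Injectivity holds because all characters vanish at the same arguments.\<close>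

lemma bij_betw_dchars_times:
  assumes "\<psi> \<in> dchars N" "N > 0"
  shows "bij_betw (\<lambda>\<phi> n. \<psi> n * \<phi> n) (dchars N) (dchars N)"
proof -
  have inj: "inj_on (\<lambda>\<phi> n. \<psi> n * \<phi> n) (dchars N)"
  proof (intro inj_onI ext)
    fix \<phi> \<rho> n assume *: "\<phi> \<in> dchars N" "\<rho> \<in> dchars N" "(\<lambda>n. \<psi> n * \<phi> n) = (\<lambda>n. \<psi> n * \<rho> n)"
    from *(3) have "\<psi> n * \<phi> n = \<psi> n * \<rho> n" by meson
    thus "\<phi> n = \<rho> n" using dchars_eq_0_iff[OF *(1), of n] dchars_eq_0_iff[OF *(2), of n]
        dchars_eq_0_iff[OF assms(1), of n] by auto
  qed
  moreover have "(\<lambda>\<phi> n. \<psi> n * \<phi> n) ` dchars N \<subseteq> dchars N"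
    using assms(1) dchars_times by blast
  ultimately show ?thesis
    using finite_dchars[OF assms(2)] by (simp add: bij_betw_def endo_inj_surj)
qed

text \<open>Translation by \<open>\<psi>\<close> permutes the characters, so the sum equals itself
  times \<open>\<psi> n\<close>.\<close>

lemma sum_dchars_eq_0:
  assumes "\<psi> \<in> dchars N" "\<psi> n \<noteq> 1" "N > 0"
  shows "(\<Sum>\<phi>\<in>dchars N. \<phi> n) = 0"
proof -
  have "(\<Sum>\<phi>\<in>dchars N. \<phi> n) = (\<Sum>\<phi>\<in>dchars N. \<psi> n * \<phi> n)"
    using sum.reindex_bij_betw[OF bij_betw_dchars_times[OF assms(1,3)], of "\<lambda>\<phi>. \<phi> n"] by simp
  also have "\<dots> = \<psi> n * (\<Sum>\<phi>\<in>dchars N. \<phi> n)"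
    by (simp add: sum_distrib_left)
  finally show ?thesis using assms(2) by (metis mult_cancel_right1)
qed

text \<open>Lagrange's theorem for the group of characters: translating the nonzero product of all
  \<open>\<phi> n\<close> by \<open>\<psi>\<close> multiplies it by
  \<open>\<psi> n ^ card (dchars N)\<close>.\<close>

lemma dchars_power_card:
  assumes "\<psi> \<in> dchars N" "coprime n N" "N > 0"
  shows "\<psi> (n ^ card (dchars N)) = 1"
proof -
  have "(\<Prod>\<phi>\<in>dchars N. \<phi> n) = (\<Prod>\<phi>\<in>dchars N. \<psi> n * \<phi> n)"
    using prod.reindex_bij_betw[OF bij_betw_dchars_times[OF assms(1,3)], of "\<lambda>\<phi>. \<phi> n"] by simp
  also have "\<dots> = \<psi> n ^ card (dchars N) * (\<Prod>\<phi>\<in>dchars N. \<phi> n)"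
    by (simp add: prod.distrib)
  finally have "\<psi> n ^ card (dchars N) = 1 \<or> (\<Prod>\<phi>\<in>dchars N. \<phi> n) = 0"
    by (metis mult_cancel_right1)
  moreover have "(\<Prod>\<phi>\<in>dchars N. \<phi> n) \<noteq> 0"
    using finite_dchars assms by (auto simp: dchars_eq_0_iff)
  ultimately show ?thesis using dchars_power[OF assms(1)] by simp
qed

text \<open>The dual translation argument: some unit \<open>a\<close> has
  \<open>\<psi> a \<noteq> 1\<close>, and \<open>r \<mapsto> a r\<close> permutes the residues. The
  vanishing of this sum is what removes the pole of the L-function at 1.\<close>

lemma sum_nonprincipal_dchar:
  assumes "\<psi> \<in> dchars N" "\<psi> \<noteq> principal_dchar N" "N > 0"
  shows "(\<Sum>r<N. \<psi> r) = 0"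
proof -
  obtain a where a: "coprime a N" "\<psi> a \<noteq> 1"
    using assms dchars_eq_0_iff[OF assms(1)] by (auto simp: principal_dchar_def fun_eq_iff split: if_splits)
  have "inj_on (\<lambda>r. (a * r) mod N) {..<N}"
  proof (rule inj_onI)
    fix x y assume xy: "x \<in> {..<N}" "y \<in> {..<N}" "(a * x) mod N = (a * y) mod N"
    hence "[x = y] (mod N)" using a(1) cong_mult_lcancel_nat[of a N x y] by (simp add: cong_def)
    thus "x = y" using xy by (simp add: cong_def)
  qed
  moreover have "(\<lambda>r. (a * r) mod N) ` {..<N} \<subseteq> {..<N}" using assms(3) by auto
  ultimately have "bij_betw (\<lambda>r. (a * r) mod N) {..<N} {..<N}"
    by (simp add: bij_betw_def endo_inj_surj)
  from sum.reindex_bij_betw[OF this, of \<psi>] have "(\<Sum>r<N. \<psi> r) = (\<Sum>r<N. \<psi> a * \<psi> r)"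
    by (simp add: dchars_mod[OF assms(1)] dchars_mult[OF assms(1)])
  also have "\<dots> = \<psi> a * (\<Sum>r<N. \<psi> r)" by (simp add: sum_distrib_left)
  finally show ?thesis using a(2) by (metis mult_cancel_right1)
qed

section \<open>Extension of characters from subgroups and orthogonality\<close>

text \<open>A character on a subgroup of the units modulo \<open>N\<close>, the subgroup being represented by the
  union \<open>H\<close> of its residue classes.\<close>

definition partial_dchar :: "nat \<Rightarrow> nat set \<Rightarrow> (nat \<Rightarrow> complex) \<Rightarrow> bool" where
  "partial_dchar N H \<psi> \<longleftrightarrow> 1 \<in> H \<and> (\<forall>a\<in>H. coprime a N \<and> \<psi> a \<noteq> 0) \<and>
     (\<forall>a\<in>H. \<forall>b\<in>H. a * b \<in> H \<and> \<psi> (a * b) = \<psi> a * \<psi> b) \<and>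
     (\<forall>a\<in>H. \<forall>b. [a = b] (mod N) \<longrightarrow> b \<in> H \<and> \<psi> b = \<psi> a)"

lemma partial_dcharD:
  assumes "partial_dchar N H \<psi>"
  shows "1 \<in> H" "a \<in> H \<Longrightarrow> coprime a N" "a \<in> H \<Longrightarrow> \<psi> a \<noteq> 0"
    "a \<in> H \<Longrightarrow> b \<in> H \<Longrightarrow> a * b \<in> H" "a \<in> H \<Longrightarrow> b \<in> H \<Longrightarrow> \<psi> (a * b) = \<psi> a * \<psi> b"
    "a \<in> H \<Longrightarrow> [a = b] (mod N) \<Longrightarrow> b \<in> H" "a \<in> H \<Longrightarrow> [a = b] (mod N) \<Longrightarrow> \<psi> b = \<psi> a"
  using assms unfolding partial_dchar_def by blast+

lemma partial_dchar_power:
  assumes "partial_dchar N H \<psi>" "a \<in> H"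
  shows "a ^ k \<in> H" "\<psi> (a ^ k) = \<psi> a ^ k"
proof -
  note D = partial_dcharD[OF assms(1)]
  have 1: "\<psi> 1 = 1" using D(5)[OF D(1) D(1)] D(3)[OF D(1)] by simp
  have "a ^ k \<in> H \<and> \<psi> (a ^ k) = \<psi> a ^ k"
  proof (induction k)
    case (Suc k)
    thus ?case using D(4,5)[OF assms(2), of "a ^ k"] by simp
  qed (use 1 D(1) in simp)
  thus "a ^ k \<in> H" "\<psi> (a ^ k) = \<psi> a ^ k" by auto
qed

text \<open>With \<open>t = totient N\<close>, the power \<open>a ^ (t - 1)\<close> inverts
  \<open>a\<close> modulo \<open>N\<close> and lies in \<open>H\<close>.\<close>

lemma partial_dchar_cancel:
  assumes "partial_dchar N H \<psi>" "N > 0" "a \<in> H" "a * b \<in> H"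
  shows "b \<in> H"
proof -
  note D = partial_dcharD[OF assms(1)]
  define t where "t = totient N"
  have t: "t > 0" using assms(2) by (simp add: t_def)
  have "[a ^ t * b = 1 * b] (mod N)"
    unfolding t_def using D(2)[OF assms(3)] by (intro cong_mult euler_theorem) auto
  moreover have "a ^ t * b = a ^ (t - 1) * (a * b)"
    using t by (cases t) (auto simp: mult_ac)
  ultimately have "[a ^ (t - 1) * (a * b) = b] (mod N)" by simp
  thus ?thesis
    by (rule D(6)[OF D(4)[OF partial_dchar_power(1)[OF assms(1,3)] assms(4)]])
qed

text \<open>The extension sends \<open>h * g ^ k\<close> to \<open>\<psi> h * z ^ k\<close>. It is
  well defined because \<open>m\<close> is the order of \<open>g\<close> modulo \<open>H\<close> and
  \<open>z\<close> is an \<open>m\<close>-th root of \<open>\<psi> (g ^ m)\<close>. Leaving the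
  choice of the root open is what later allows characters to be separated.\<close>

lemma partial_dchar_extend:
  assumes \<psi>: "partial_dchar N H \<psi>" and N: "N > 0" and g: "coprime g N"
    and m: "m > 0" "g ^ m \<in> H" "\<And>k. 0 < k \<Longrightarrow> k < m \<Longrightarrow> g ^ k \<notin> H"
    and z: "z ^ m = \<psi> (g ^ m)"
  obtains H' \<psi>' where "partial_dchar N H' \<psi>'" "H \<subseteq> H'" "g \<in> H'" "\<And>h. h \<in> H \<Longrightarrow> \<psi>' h = \<psi> h" "\<psi>' g = z"
proof -
  note D = partial_dcharD[OF \<psi>]
  have z0: "z \<noteq> 0" using z m D(3)[OF m(2)] by (auto simp: zero_power)
  have 1: "\<psi> 1 = 1" using D(5)[OF D(1) D(1)] D(3)[OF D(1)] by simp
  \<comment> \<open>\<open>R\<close> is the graph of the extension; \<open>uniq\<close> shows that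
    it is single-valued.\<close>
  define R where "R = (\<lambda>n w. \<exists>h\<in>H. \<exists>k. [n = h * g ^ k] (mod N) \<and> w = \<psi> h * z ^ k)"
  \<comment> \<open>Two representations of one class with exponents \<open>k\<close> and
    \<open>k + l\<close>: cancelling \<open>g ^ k\<close> and then \<open>h'\<close> puts
    \<open>g ^ l\<close> into \<open>H\<close>. By minimality \<open>m\<close> divides
    \<open>l\<close>, whence \<open>\<psi> (g ^ l) = z ^ l\<close>.\<close>
  have key: "\<psi> h * z ^ k = \<psi> h' * z ^ (k + l)"
    if H: "h \<in> H" "h' \<in> H" and c: "[h * g ^ k = h' * g ^ (k + l)] (mod N)" for h h' k l
  proof -
    have "[g ^ k * h = g ^ k * (h' * g ^ l)] (mod N)"
      using c by (simp add: power_add mult_ac)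
    hence c': "[h = h' * g ^ l] (mod N)"
      using g by (subst (asm) cong_mult_lcancel_nat) auto
    hence gl: "h' * g ^ l \<in> H" and \<psi>h: "\<psi> (h' * g ^ l) = \<psi> h" using D(6,7) H by blast+
    hence "g ^ l \<in> H" using partial_dchar_cancel[OF \<psi> N] H by blast
    moreover have "g ^ l = (g ^ m) ^ (l div m) * g ^ (l mod m)"
      by (simp flip: power_mult power_add)
    ultimately have "g ^ (l mod m) \<in> H"
      using partial_dchar_cancel[OF \<psi> N partial_dchar_power(1)[OF \<psi> m(2), of "l div m"], of "g ^ (l mod m)"]
      by simp
    hence "l mod m = 0" using m(3)[of "l mod m"] m(1) by force
    then obtain q where q: "l = m * q" by blast
    have "\<psi> (g ^ l) = z ^ l"
      using partial_dchar_power(2)[OF \<psi> m(2)] by (simp add: q power_mult z)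
    with \<psi>h \<open>g ^ l \<in> H\<close> H show ?thesis by (simp add: D(5) power_add)
  qed
  have uniq: "w = w'" if "R n w" "R n w'" for n w w'
  proof -
    from that obtain h k h' k' where *: "h \<in> H" "[n = h * g ^ k] (mod N)" "w = \<psi> h * z ^ k"
      "h' \<in> H" "[n = h' * g ^ k'] (mod N)" "w' = \<psi> h' * z ^ k'" unfolding R_def by blast
    have c: "[h * g ^ k = h' * g ^ k'] (mod N)" by (rule cong_trans[OF cong_sym[OF *(2)] *(5)])
    show ?thesis
    proof (cases "k \<le> k'")
      case True
      then obtain l where "k' = k + l" using le_Suc_ex by blast
      thus ?thesis using key[OF *(1,4), of k l] c * by simp
    next
      case False
      then obtain l where "k = k' + l" using le_Suc_ex[of k' k] by auto
      thus ?thesis using key[OF *(4,1), of k' l] cong_sym[OF c] * by simp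
    qed
  qed
  define \<psi>' where "\<psi>' = (\<lambda>n. THE w. R n w)"
  define H' where "H' = {n. \<exists>w. R n w}"
  have \<psi>': "\<psi>' n = w" if "R n w" for n w
    unfolding \<psi>'_def using that uniq by blast
  have R_mult: "R (a * b) (w * w')" if R: "R a w" "R b w'" for a b w w'
  proof -
    from R obtain h k h' k' where *: "h \<in> H" "[a = h * g ^ k] (mod N)" "w = \<psi> h * z ^ k"
      "h' \<in> H" "[b = h' * g ^ k'] (mod N)" "w' = \<psi> h' * z ^ k'" unfolding R_def by blast
    have "[a * b = (h * h') * g ^ (k + k')] (mod N)"
      using cong_mult[OF *(2,5)] by (simp add: power_add mult_ac)
    moreover have "w * w' = \<psi> (h * h') * z ^ (k + k')"
      using * by (simp add: D(5) power_add mult_ac)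
    ultimately show ?thesis unfolding R_def using D(4)[OF *(1,4)] by blast
  qed
  have R_cong: "R b w" if "R a w" "[a = b] (mod N)" for a b w
    using that cong_trans[OF cong_sym[OF that(2)]] unfolding R_def by blast
  have R_H: "R h (\<psi> h)" if "h \<in> H" for h
    unfolding R_def using that by (intro bexI[of _ h] exI[of _ 0]) auto
  have R_g: "R g z"
    unfolding R_def using D(1) 1 by (intro bexI[of _ 1] exI[of _ 1]) auto
  have R_nz: "w \<noteq> 0 \<and> coprime n N" if "R n w" for n w
  proof -
    from that obtain h k where *: "h \<in> H" "[n = h * g ^ k] (mod N)" "w = \<psi> h * z ^ k"
      unfolding R_def by blast
    have "coprime (h * g ^ k) N" using D(2)[OF *(1)] g by simp
    thus ?thesis using * z0 D(3) cong_imp_coprime[OF cong_sym[OF *(2)]] by auto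
  qed
  have "partial_dchar N H' \<psi>'"
    unfolding partial_dchar_def
  proof (intro conjI ballI allI impI)
    show "1 \<in> H'" using R_H[OF D(1)] by (auto simp: H'_def)
  next
    fix a assume "a \<in> H'"
    then obtain w where w: "R a w" by (auto simp: H'_def)
    thus "coprime a N" "\<psi>' a \<noteq> 0" using R_nz \<psi>'[OF w] by auto
    show "b \<in> H'" "\<psi>' b = \<psi>' a" if "[a = b] (mod N)" for b
      using R_cong[OF w that] \<psi>'[OF w] \<psi>' by (auto simp: H'_def)
    show "a * b \<in> H'" "\<psi>' (a * b) = \<psi>' a * \<psi>' b" if b: "b \<in> H'" for b
    proof -
      obtain v where v: "R b v" using b by (auto simp: H'_def)
      show "a * b \<in> H'" "\<psi>' (a * b) = \<psi>' a * \<psi>' b"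
        using R_mult[OF w v] \<psi>'[OF w] \<psi>'[OF v] \<psi>' by (auto simp: H'_def)
    qed
  qed
  thus ?thesis
    using R_H R_g \<psi>' by (intro that[of H' \<psi>']) (auto simp: H'_def)
qed

lemma partial_dchar_order:
  assumes \<psi>: "partial_dchar N H \<psi>" and N: "N > 0" and g: "coprime g N"
  obtains m where "m > 0" "g ^ m \<in> H" "\<And>k. 0 < k \<Longrightarrow> k < m \<Longrightarrow> g ^ k \<notin> H"
proof -
  define m where "m = (LEAST m. m > 0 \<and> g ^ m \<in> H)"
  have "totient N > 0 \<and> g ^ totient N \<in> H"
    using N partial_dcharD(6)[OF \<psi> partial_dcharD(1)[OF \<psi>] cong_sym[OF euler_theorem[OF g]]] by simp
  hence "m > 0 \<and> g ^ m \<in> H" unfolding m_def by (rule LeastI)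
  moreover have "g ^ k \<notin> H" if "0 < k" "k < m" for k
    using not_less_Least[of k "\<lambda>m. m > 0 \<and> g ^ m \<in> H"] that unfolding m_def by auto
  ultimately show ?thesis using that by blast
qed

text \<open>Induction on the number of unit residues outside \<open>H\<close>: each step adjoins a
  missing unit \<open>g\<close>, with an arbitrary admissible value at \<open>g\<close>.\<close>

lemma partial_dchar_extend_all:
  assumes "partial_dchar N H \<psi>" "N > 0"
  shows "\<exists>\<phi>\<in>dchars N. \<forall>h\<in>H. \<phi> h = \<psi> h"
  using assms
proof (induction "card ({n. n < N \<and> coprime n N} - H)" arbitrary: H \<psi> rule: less_induct)
  case less
  note D = partial_dcharD[OF less.prems(1)]
  show ?case
  proof (cases "\<exists>g. coprime g N \<and> g \<notin> H")
    case True
    then obtain g where g: "coprime g N" "g \<notin> H" by blast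
    obtain m where m: "m > 0" "g ^ m \<in> H" "\<And>k. 0 < k \<Longrightarrow> k < m \<Longrightarrow> g ^ k \<notin> H"
      using partial_dchar_order[OF less.prems g(1)] by blast
    define z where "z = exp (Ln (\<psi> (g ^ m)) / of_nat m)"
    have "z ^ m = \<psi> (g ^ m)"
      using m D(3)[OF m(2)] by (simp add: z_def flip: exp_of_nat_mult)
    then obtain H' \<psi>' where H': "partial_dchar N H' \<psi>'" "H \<subseteq> H'" "g \<in> H'" "\<And>h. h \<in> H \<Longrightarrow> \<psi>' h = \<psi> h"
      using partial_dchar_extend[OF less.prems g(1) m] by metis
    have "[g = g mod N] (mod N)" by simp
    hence gN: "g mod N < N" "coprime (g mod N) N" "g mod N \<in> H'" "g mod N \<notin> H"
      using less.prems(2) g partial_dcharD(6)[OF H'(1) H'(3)] D(6) by auto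
    have "card ({n. n < N \<and> coprime n N} - H') < card ({n. n < N \<and> coprime n N} - H)"
      using gN H'(2) by (intro psubset_card_mono) auto
    from less.hyps[OF this H'(1) less.prems(2)] show ?thesis
      using H'(2,4) by (metis subsetD)
  next
    case False
    \<comment> \<open>Now \<open>H\<close> contains every unit, and extension by zero yields a
      Dirichlet character.\<close>
    define \<phi> where "\<phi> = (\<lambda>n. if coprime n N then \<psi> n else 0)"
    have "\<phi> (n + N) = \<phi> n" for n
      using D(7)[of n "n + N"] False by (auto simp: \<phi>_def cong_def coprime_add_self_left)
    moreover have "\<phi> n \<noteq> 0 \<longleftrightarrow> coprime n N" for n using False D(3) by (auto simp: \<phi>_def)
    moreover have "\<phi> (m * n) = \<phi> m * \<phi> n" for m n using False D(5) by (auto simp: \<phi>_def)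
    ultimately have "\<phi> \<in> dchars N" by (simp add: dchars_def)
    thus ?thesis using D(2) by (intro bexI[of _ \<phi>]) (auto simp: \<phi>_def)
  qed
qed

text \<open>The trivial character on the residue class of 1 is extended to \<open>a\<close>, with a
  primitive root of unity of order \<open>m\<close> as its value there, \<open>m\<close> being the
  order of \<open>a\<close>; then it is extended to all units.\<close>

lemma dchars_separate:
  assumes N: "N > 0" and a: "coprime a N" "\<not> [a = 1] (mod N)"
  obtains \<psi> where "\<psi> \<in> dchars N" "\<psi> a \<noteq> 1"
proof -
  define H where "H = {n. [n = 1] (mod N)}"
  have triv: "partial_dchar N H (\<lambda>_. 1)"
    unfolding partial_dchar_def H_def
    using cong_mult[of _ 1 N _ 1] cong_imp_coprime[OF cong_sym, of _ 1 N]
    by (auto intro: cong_trans[OF cong_sym])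
  obtain m where m: "m > 0" "a ^ m \<in> H" "\<And>k. 0 < k \<Longrightarrow> k < m \<Longrightarrow> a ^ k \<notin> H"
    using partial_dchar_order[OF triv N a(1)] by blast
  have "m \<noteq> 1" using m(2) a(2) by (auto simp: H_def)
  hence m2: "m \<ge> 2" using m(1) by simp
  define z where "z = cis (2 * pi / real m)"
  have "z ^ m = cis (real m * (2 * pi / real m))" unfolding z_def by (rule Complex.DeMoivre)
  also have "\<dots> = 1" using m(1) by simp
  finally have "z ^ m = 1" .
  moreover have "z \<noteq> 1"
    using complex_root_unity_eq_1[of m 1] m2 by (simp add: z_def cis_conv_exp mult_ac)
  ultimately show ?thesis
    using partial_dchar_extend[OF triv N a(1) m, of z] partial_dchar_extend_all[OF _ N] that by metis
qed

lemma sum_dchars: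
  assumes "N > 0"
  shows "(\<Sum>\<phi>\<in>dchars N. \<phi> n) = (if [n = 1] (mod N) then of_nat (card (dchars N)) else 0)"
proof (cases "[n = 1] (mod N)")
  case True
  have "(\<Sum>\<phi>\<in>dchars N. \<phi> n) = (\<Sum>\<phi>\<in>dchars N. 1)"
    using dchars_cong[OF _ True] dchars_1 by (intro sum.cong refl) metis
  thus ?thesis using True by simp
next
  case False
  have "\<exists>\<psi>\<in>dchars N. \<psi> n \<noteq> 1"
  proof (cases "coprime n N")
    case True
    with False show ?thesis using dchars_separate[OF assms] by metis
  next
    case False
    \<comment> \<open>At a non-unit the principal character has the value 0, which differs from
      1.\<close>
    thus ?thesis using principal_dchar_in_dchars by (metis dchars_eq_0_iff zero_neq_one)
  qed
  thus ?thesis using sum_dchars_eq_0 assms False by auto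
qed

section \<open>Dirichlet series\<close>

text \<open>The term for \<open>n = 0\<close> vanishes because \<open>0 powr z = 0\<close>.\<close>

definition dseries :: "(nat \<Rightarrow> complex) \<Rightarrow> complex \<Rightarrow> complex" where
  "dseries a s = (\<Sum>n. a n * of_nat n powr (-s))"

text \<open>The abscissa of absolute convergence is at most 1. Asking for the whole half-plane makes
  the property stable under the factors \<open>ln n\<close> that differentiation produces.\<close>

definition abs_conv :: "(nat \<Rightarrow> complex) \<Rightarrow> bool" where
  "abs_conv a \<longleftrightarrow> (\<forall>\<sigma>>1. summable (\<lambda>n. norm (a n) * real n powr (-\<sigma>)))"

lemma norm_nat_powr: "norm (of_nat n powr s :: complex) = real n powr Re s"
  by (simp add: norm_powr_real_powr)

lemma abs_conv_bounded:
  assumes "\<And>n. norm (a n) \<le> C"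
  shows "abs_conv a"
  unfolding abs_conv_def
proof (intro allI impI)
  fix \<sigma> :: real assume "\<sigma> > 1"
  show "summable (\<lambda>n. norm (a n) * real n powr (-\<sigma>))"
  proof (rule summable_comparison_test')
    show "summable (\<lambda>n. C * real n powr (-\<sigma>))"
      using \<open>\<sigma> > 1\<close> by (intro summable_mult) (simp add: summable_real_powr_iff)
    show "norm (norm (a n) * real n powr (-\<sigma>)) \<le> C * real n powr (-\<sigma>)" for n
      using assms[of n] by (simp add: mult_right_mono)
  qed
qed

lemma abs_conv_mult_bounded:
  assumes "abs_conv a" "\<And>n. norm (b n) \<le> C * norm (a n)"
  shows "abs_conv b"
  unfolding abs_conv_def
proof (intro allI impI)
  fix \<sigma> :: real assume "\<sigma> > 1"
  show "summable (\<lambda>n. norm (b n) * real n powr (-\<sigma>))"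
  proof (rule summable_comparison_test')
    show "summable (\<lambda>n. C * (norm (a n) * real n powr (-\<sigma>)))"
      using \<open>\<sigma> > 1\<close> assms(1) by (intro summable_mult) (simp add: abs_conv_def)
    show "norm (norm (b n) * real n powr (-\<sigma>)) \<le> C * (norm (a n) * real n powr (-\<sigma>))" for n
      using mult_right_mono[OF assms(2), of "real n powr (-\<sigma>)" n] by (simp add: mult.assoc)
  qed
qed

lemma abs_conv_ln:
  assumes "abs_conv a"
  shows "abs_conv (\<lambda>n. a n * of_real (ln (real n)))"
  unfolding abs_conv_def
proof (intro allI impI)
  fix \<sigma> :: real assume \<sigma>: "\<sigma> > 1"
  \<comment> \<open>Half of the margin \<open>\<sigma> - 1\<close> absorbs the logarithm through
    \<open>ln n \<le> n powr e / e\<close>; the other half keeps the series convergent.\<close>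
  define e where "e = (\<sigma> - 1) / 2"
  have e: "e > 0" "\<sigma> - e > 1" using \<sigma> by (auto simp: e_def field_simps)
  show "summable (\<lambda>n. norm (a n * of_real (ln (real n))) * real n powr (-\<sigma>))"
  proof (rule summable_comparison_test')
    show "summable (\<lambda>n. (1 / e) * (norm (a n) * real n powr (-(\<sigma> - e))))"
      using e assms unfolding abs_conv_def by (intro summable_mult) blast
    fix n :: nat assume n: "n \<ge> 1"
    have "norm (a n * of_real (ln (real n))) * real n powr (-\<sigma>)
          = norm (a n) * (ln (real n) * real n powr (-\<sigma>))"
      using n by (simp add: norm_mult)
    also have "\<dots> \<le> norm (a n) * ((real n powr e / e) * real n powr (-\<sigma>))"
      using n e by (intro mult_left_mono mult_right_mono ln_powr_bound) auto
    also have "\<dots> = (1 / e) * (norm (a n) * real n powr (-(\<sigma> - e)))"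
      by (simp add: powr_add [symmetric])
    finally show "norm (norm (a n * of_real (ln (real n))) * real n powr (-\<sigma>)) \<le>
       (1 / e) * (norm (a n) * real n powr (-(\<sigma> - e)))" by simp
  qed
qed

lemma abs_conv_summable_norm:
  assumes "abs_conv a" "Re s > 1"
  shows "summable (\<lambda>n. norm (a n * of_nat n powr (-s)))"
  using assms by (simp add: abs_conv_def norm_mult norm_nat_powr)

lemma dseries_sums:
  assumes "abs_conv a" "Re s > 1"
  shows "(\<lambda>n. a n * of_nat n powr (-s)) sums dseries a s"
  unfolding dseries_def
  using summable_norm_cancel[OF abs_conv_summable_norm[OF assms]] by (rule summable_sums)

lemma has_field_derivative_nat_powr:
  "((\<lambda>s::complex. of_nat n powr (-s)) has_field_derivative - of_real (ln (real n)) * of_nat n powr (-s)) (at s)"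
proof (cases "n = 0")
  case False
  have "((\<lambda>s::complex. exp (- s * of_real (ln (real n)))) has_field_derivative
           - of_real (ln (real n)) * exp (- s * of_real (ln (real n)))) (at s)"
    by (auto intro!: derivative_eq_intros)
  moreover have "of_nat n powr (-s) = exp (- s * of_real (ln (real n)))" for s :: complex
    using False by (simp add: powr_def Ln_of_nat)
  ultimately show ?thesis by simp
qed simp

lemma has_field_derivative_dseries:
  assumes a: "abs_conv a" and s: "Re s > 1"
  shows "(dseries a has_field_derivative dseries (\<lambda>n. - (a n * of_real (ln (real n)))) s) (at s)"
proof -
  let ?S = "{s. Re s > 1}"
  have op: "open ?S" by (simp add: open_halfspace_Re_gt)
  have "\<exists>g g'. \<forall>x \<in> ?S. ((\<lambda>n. a n * of_nat n powr (-x)) sums g x) \<and>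
      ((\<lambda>n. - (a n * of_real (ln (real n))) * of_nat n powr (-x)) sums g' x) \<and>
      (g has_field_derivative g' x) (at x)"
  proof (rule series_and_derivative_comparison_local[OF op])
    show "((\<lambda>x. a n * of_nat n powr (-x)) has_field_derivative
       - (a n * of_real (ln (real n))) * of_nat n powr (-x)) (at x)" for n x
      using DERIV_cmult[OF has_field_derivative_nat_powr[of n x], of "a n"]
      by (simp add: mult_ac)
    fix x :: complex assume x: "x \<in> ?S"
    \<comment> \<open>On the ball of radius \<open>d\<close> about \<open>x\<close> real parts
      exceed \<open>1 + d\<close>, so the Weierstrass test applies with the terms at
      \<open>1 + d\<close>.\<close>
    define d where "d = (Re x - 1) / 2"
    have d: "d > 0" "1 + d > 1" "Re x - d = 1 + d" using x by (auto simp: d_def field_simps)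
    have "\<forall>n. \<forall>y\<in>ball x d \<inter> ?S. norm (a n * of_nat n powr (-y)) \<le> norm (a n) * real n powr (-(1+d))"
    proof (intro allI ballI)
      fix n y assume y: "y \<in> ball x d \<inter> ?S"
      show "norm (a n * of_nat n powr (-y)) \<le> norm (a n) * real n powr (-(1+d))"
      proof (cases "n = 0")
        case False
        have "\<bar>Re (x - y)\<bar> \<le> norm (x - y)" by (rule abs_Re_le_cmod)
        also have "\<dots> < d" using y by (simp add: dist_norm)
        finally have "Re y > 1 + d" using d by auto
        with False show ?thesis
          unfolding norm_mult norm_nat_powr
          by (intro mult_left_mono powr_mono) auto
      qed auto
    qed
    moreover have "summable (\<lambda>n. norm (a n) * real n powr (-(1+d)))"
      using a d unfolding abs_conv_def by blast
    ultimately show "\<exists>d h. 0 < d \<and> summable h \<and>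
       (\<forall>\<^sub>F n in sequentially. \<forall>y\<in>ball x d \<inter> ?S. norm (a n * of_nat n powr (-y)) \<le> h n)"
      using d
      by (intro exI[of _ d] exI[of _ "\<lambda>n. norm (a n) * real n powr (-(1+d))"]) auto
  qed
  then obtain g g' where g: "\<And>x. Re x > 1 \<Longrightarrow> (\<lambda>n. a n * of_nat n powr (-x)) sums g x"
    "\<And>x. Re x > 1 \<Longrightarrow> (\<lambda>n. - (a n * of_real (ln (real n))) * of_nat n powr (-x)) sums g' x"
    "\<And>x. Re x > 1 \<Longrightarrow> (g has_field_derivative g' x) (at x)"
    by auto
  have "g' s = dseries (\<lambda>n. - (a n * of_real (ln (real n)))) s"
    using g(2)[OF s] by (simp add: dseries_def sums_iff)
  moreover have "dseries a x = g x" if "x \<in> ?S" for x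
    using g(1)[of x] that by (simp add: dseries_def sums_iff)
  ultimately show ?thesis
    using has_field_derivative_transform_within_open[OF g(3)[OF s] op, of "dseries a"] s by simp
qed

lemma dseries_cmult:
  assumes "abs_conv a" "Re s > 1"
  shows "dseries (\<lambda>n. c * a n) s = c * dseries a s"
  using sums_mult[OF dseries_sums[OF assms], of c]
  by (simp add: dseries_def sums_iff mult.assoc)

lemma dseries_sum:
  assumes "\<And>i. i \<in> I \<Longrightarrow> abs_conv (a i)" "Re s > 1"
  shows "dseries (\<lambda>n. \<Sum>i\<in>I. a i n) s = (\<Sum>i\<in>I. dseries (a i) s)"
proof -
  have "(\<lambda>n. \<Sum>i\<in>I. a i n * of_nat n powr (-s)) sums (\<Sum>i\<in>I. dseries (a i) s)"
    using assms by (intro sums_sum dseries_sums) auto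
  thus ?thesis by (simp add: dseries_def sums_iff sum_distrib_right)
qed

lemma holomorphic_dseries:
  assumes "abs_conv a"
  shows "dseries a holomorphic_on {s. Re s > 1}"
  using has_field_derivative_dseries[OF assms]
  by (subst holomorphic_on_open) (auto simp: open_halfspace_Re_gt)

lemma higher_deriv_dseries:
  assumes "abs_conv a" "Re s > 1"
  shows "(deriv ^^ k) (dseries a) s = (-1) ^ k * dseries (\<lambda>n. a n * of_real (ln (real n) ^ k)) s"
    and "abs_conv (\<lambda>n. a n * of_real (ln (real n) ^ k))"
proof -
  have "abs_conv (\<lambda>n. a n * of_real (ln (real n) ^ k)) \<and> (\<forall>s. Re s > 1 \<longrightarrow>
     (deriv ^^ k) (dseries a) s = (-1) ^ k * dseries (\<lambda>n. a n * of_real (ln (real n) ^ k)) s)"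
  proof (induction k)
    case (Suc k)
    let ?b = "\<lambda>n. a n * of_real (ln (real n) ^ k)"
    have b: "abs_conv ?b" using Suc by blast
    have ab: "abs_conv (\<lambda>n. a n * of_real (ln (real n) ^ Suc k))"
      using abs_conv_ln[OF b] by (simp add: mult_ac)
    have "(deriv ^^ Suc k) (dseries a) s = (-1) ^ Suc k * dseries (\<lambda>n. a n * of_real (ln (real n) ^ Suc k)) s"
      if s: "Re s > 1" for s
    proof -
      have "((\<lambda>s. (-1) ^ k * dseries ?b s) has_field_derivative
              (-1) ^ k * dseries (\<lambda>n. - (?b n * of_real (ln (real n)))) s) (at s)"
        by (intro DERIV_cmult has_field_derivative_dseries b s)
      hence "((deriv ^^ k) (dseries a) has_field_derivative
              (-1) ^ k * dseries (\<lambda>n. - (?b n * of_real (ln (real n)))) s) (at s)"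
        by (rule has_field_derivative_transform_within_open[where S = "{s. Re s > 1}"])
           (use Suc s in \<open>auto simp: open_halfspace_Re_gt\<close>)
      hence "(deriv ^^ Suc k) (dseries a) s = (-1) ^ k * dseries (\<lambda>n. - (?b n * of_real (ln (real n)))) s"
        by (simp add: DERIV_imp_deriv)
      also have "(\<lambda>n. - (?b n * of_real (ln (real n)))) = (\<lambda>n. (-1) * (a n * of_real (ln (real n) ^ Suc k)))"
        by (simp add: mult_ac)
      also have "dseries \<dots> s = (-1) * dseries (\<lambda>n. a n * of_real (ln (real n) ^ Suc k)) s"
        by (rule dseries_cmult[OF ab s])
      finally show ?thesis by simp
    qed
    with ab show ?case by blast
  qed (use assms in simp)
  thus "(deriv ^^ k) (dseries a) s = (-1) ^ k * dseries (\<lambda>n. a n * of_real (ln (real n) ^ k)) s"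
    and "abs_conv (\<lambda>n. a n * of_real (ln (real n) ^ k))" using assms by auto
qed

section \<open>Von Mangoldt's function and logarithmic derivatives\<close>

lemma abs_conv_mangoldt:
  assumes "\<And>n. norm (a n) \<le> C"
  shows "abs_conv (\<lambda>n. a n * mangoldt n)"
proof (rule abs_conv_mult_bounded[where C = 1])
  show "abs_conv (\<lambda>n. a n * of_real (ln (real n)))"
    using assms by (intro abs_conv_ln abs_conv_bounded)
  fix n :: nat
  have "mangoldt n \<le> \<bar>ln (real n)\<bar>"
  proof (cases "n = 0")
    case False
    \<comment> \<open>The value at \<open>n\<close> is one nonnegative term of the divisor sum,
      which equals \<open>ln n\<close>.\<close>
    have "mangoldt n \<le> (\<Sum>d | d dvd n. mangoldt d :: real)"
      using False by (intro member_le_sum) (auto simp: mangoldt_nonneg)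
    thus ?thesis using False by (subst (asm) mangoldt_sum) auto
  qed auto
  thus "norm (a n * mangoldt n) \<le> 1 * norm (a n * of_real (ln (real n)))"
    by (simp add: norm_mult mult_left_mono)
qed

lemma has_sum_times:
  fixes f :: "'a \<Rightarrow> 'c :: {real_normed_field, banach}" and g :: "'b \<Rightarrow> 'c"
  assumes abs: "(\<lambda>x. norm (f x)) summable_on A" "(\<lambda>y. norm (g y)) summable_on B"
    and sum: "(f has_sum a) A" "(g has_sum b) B"
  shows "((\<lambda>(x,y). f x * g y) has_sum a * b) (A \<times> B)"
proof (rule has_sum_SigmaI)
  show "((\<lambda>y. (\<lambda>(x,y). f x * g y) (x, y)) has_sum f x * b) B" for x
    using has_sum_cmult_right[OF sum(2), of "f x"] by simp
  show "((\<lambda>x. f x * b) has_sum a * b) A"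
    by (rule has_sum_cmult_left[OF sum(1)])
  have "(\<lambda>z. norm ((\<lambda>(x,y). f x * g y) z)) summable_on (A \<times> B)"
    unfolding Infinite_Sum.abs_summable_on_Sigma_iff
    using abs by (auto simp: norm_mult infsum_cmult_right' infsum_nonneg abs_mult intro!: summable_on_cmult_left summable_on_cmult_right)
  thus "(\<lambda>(x,y). f x * g y) summable_on (A \<times> B)"
    by (rule abs_summable_summable)
qed

text \<open>The convolution identity that the divisor sum of \<open>mangoldt\<close> is
  \<open>ln\<close>, twisted by the completely multiplicative \<open>\<psi>\<close>. Absolute
  convergence allows the double series over \<open>(d, m)\<close> to be regrouped by
  \<open>n = d m\<close>.\<close>

lemma dseries_mangoldt:
  assumes mult: "\<And>m n. \<psi> (m * n) = \<psi> m * \<psi> n" and bd: "\<And>n. norm (\<psi> n) \<le> 1"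
    and s: "Re s > 1"
  shows "dseries (\<lambda>n. \<psi> n * mangoldt n) s * dseries \<psi> s = dseries (\<lambda>n. \<psi> n * of_real (ln (real n))) s"
proof -
  let ?f = "\<lambda>d. \<psi> d * mangoldt d * of_nat d powr (-s)"
  let ?g = "\<lambda>m. \<psi> m * of_nat m powr (-s)"
  let ?h = "\<lambda>n. \<psi> n * of_real (ln (real n)) * of_nat n powr (-s)"
  have ac: "abs_conv \<psi>" "abs_conv (\<lambda>n. \<psi> n * mangoldt n)" "abs_conv (\<lambda>n. \<psi> n * of_real (ln (real n)))"
    using bd by (auto intro: abs_conv_bounded abs_conv_ln abs_conv_mangoldt)
  have hs: "(?f has_sum dseries (\<lambda>n. \<psi> n * mangoldt n) s) UNIV" "(?g has_sum dseries \<psi> s) UNIV"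
    "(?h has_sum dseries (\<lambda>n. \<psi> n * of_real (ln (real n))) s) UNIV"
    using ac s by (auto intro!: norm_summable_imp_has_sum abs_conv_summable_norm dseries_sums)
  have abs: "(\<lambda>d. norm (?f d)) summable_on UNIV" "(\<lambda>m. norm (?g m)) summable_on UNIV"
    using abs_conv_summable_norm[OF ac(2) s] abs_conv_summable_norm[OF ac(1) s]
    by (auto intro!: summable_nonneg_imp_summable_on)
  have "((\<lambda>(d,m). ?f d * ?g m) has_sum dseries (\<lambda>n. \<psi> n * mangoldt n) s * dseries \<psi> s) (UNIV \<times> UNIV)"
    using has_sum_times[OF abs hs(1,2)] by simp
  also have "?this \<longleftrightarrow> ((\<lambda>(d,m). ?f d * ?g m) has_sum dseries (\<lambda>n. \<psi> n * mangoldt n) s * dseries \<psi> s) ({0<..} \<times> {0<..})"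
    by (intro has_sum_cong_neutral) auto
  also have "\<dots> \<longleftrightarrow> ((\<lambda>(n,d). ?f d * ?g (n div d)) has_sum dseries (\<lambda>n. \<psi> n * mangoldt n) s * dseries \<psi> s)
                (Sigma {0<..} (\<lambda>n. {d. d dvd n}))"
    by (intro has_sum_reindex_bij_witness[where i = "\<lambda>(n,d). (d, n div d)" and j = "\<lambda>(d,m). (d*m, d)"])
       (auto elim!: dvdE)
  finally have *: "((\<lambda>(n,d). ?f d * ?g (n div d)) has_sum dseries (\<lambda>n. \<psi> n * mangoldt n) s * dseries \<psi> s)
                (Sigma {0<..} (\<lambda>n. {d. d dvd n}))" .
  have "(?h has_sum dseries (\<lambda>n. \<psi> n * mangoldt n) s * dseries \<psi> s) {0<..}"
  proof (rule has_sum_SigmaD[OF *])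
    fix n :: nat assume n: "n \<in> {0<..}"
    have "?f d * ?g (n div d) = \<psi> n * of_nat n powr (-s) * mangoldt d" if d: "d dvd n" for d
    proof -
      obtain m where m: "n = d * m" using d by blast
      have "d > 0" "m > 0" using n m by auto
      thus ?thesis by (simp add: m mult powr_times_real)
    qed
    hence "(\<Sum>d | d dvd n. ?f d * ?g (n div d)) = \<psi> n * of_nat n powr (-s) * (\<Sum>d | d dvd n. mangoldt d)"
      unfolding sum_distrib_left by (intro sum.cong) auto
    also have "\<dots> = ?h n" using n by (simp add: mangoldt_sum)
    finally show "((\<lambda>d. (\<lambda>(n,d). ?f d * ?g (n div d)) (n, d)) has_sum ?h n) {d. d dvd n}"
      using n by (intro has_sum_finiteI) auto
  qed
  also have "?this \<longleftrightarrow> (?h has_sum dseries (\<lambda>n. \<psi> n * mangoldt n) s * dseries \<psi> s) UNIV"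
    by (intro has_sum_cong_neutral) auto
  finally show ?thesis using hs(3) has_sum_unique by blast
qed

text \<open>The formula for \<open>- L'/L\<close>, written without a quotient so that it can be used
  where nothing is known about zeros.\<close>

lemma has_field_derivative_dseries_mult:
  assumes mult: "\<And>m n. \<psi> (m * n) = \<psi> m * \<psi> n" and bd: "\<And>n. norm (\<psi> n) \<le> 1"
    and s: "Re s > 1"
  shows "(dseries \<psi> has_field_derivative - (dseries \<psi> s * dseries (\<lambda>n. \<psi> n * mangoldt n) s)) (at s)"
proof -
  have ac: "abs_conv \<psi>" using bd by (auto intro: abs_conv_bounded)
  have "dseries (\<lambda>n. (-1) * (\<psi> n * of_real (ln (real n)))) s = (-1) * dseries (\<lambda>n. \<psi> n * of_real (ln (real n))) s"
    by (intro dseries_cmult abs_conv_ln ac s)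
  with has_field_derivative_dseries[OF ac s] dseries_mangoldt[OF mult bd s] show ?thesis
    by (simp add: mult.commute)
qed

section \<open>Analytic continuation of periodic Dirichlet series\<close>

lemma norm_powr_real: "x > 0 \<Longrightarrow> norm (of_real x powr s :: complex) = x powr Re s"
  by (simp add: norm_powr_real_powr)

lemma of_real_in_closed_segment:
  assumes "w \<in> closed_segment (of_real x) (of_real (x + N) :: complex)" "N \<ge> 0"
  shows "\<exists>u. w = of_real u \<and> u \<ge> x \<and> u \<le> x + N"
proof -
  obtain u where u: "0 \<le> u" "u \<le> 1" "w = (1 - u) *\<^sub>R of_real x + u *\<^sub>R of_real (x + N)"
    using assms by (auto simp: in_segment)
  have "w = of_real (x + u * N)" by (simp add: u(3) scaleR_conv_of_real algebra_simps)
  moreover have "u * N \<le> 1 * N" using u assms(2) by (intro mult_right_mono)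
  ultimately show ?thesis using u assms(2) by (intro exI[of _ "x + u * N"]) auto
qed

text \<open>Mean value inequality along the segment; the derivative is largest at the left end
  because \<open>Re s > 0\<close>.\<close>

lemma norm_powr_diff_le:
  assumes x: "x > 0" and t: "t \<in> closed_segment (of_real x) (of_real (x + N))" and N: "N \<ge> 0" and s: "Re s > 0"
  shows "norm (t powr (-s) - of_real x powr (-s)) \<le> norm s * N * x powr (-Re s - 1)"
proof -
  let ?S = "closed_segment (of_real x) (of_real (x + N)) :: complex set"
  have S: "\<exists>u. w = of_real u \<and> u \<ge> x \<and> u \<le> x + N" if "w \<in> ?S" for w
    using of_real_in_closed_segment[of w x N] that N by simp
  have "norm (t powr (-s) - of_real x powr (-s)) \<le> (norm s * x powr (-Re s - 1)) * norm (t - of_real x)"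
  proof (rule field_differentiable_bound[where S = ?S])
    fix w assume "w \<in> ?S"
    then obtain u where u: "w = of_real u" "u \<ge> x" using S by blast
    have "w \<notin> \<real>\<^sub>\<le>\<^sub>0" using u x by auto
    thus "((\<lambda>t. t powr (-s)) has_field_derivative (-s) * w powr (-s-1)) (at w within ?S)"
      by (intro has_field_derivative_at_within[OF has_field_derivative_powr])
    have "norm ((-s) * w powr (-s-1)) = norm s * u powr (-Re s - 1)"
      using u x by (simp add: norm_mult norm_powr_real)
    also have "\<dots> \<le> norm s * x powr (-Re s - 1)"
      using u x s by (intro mult_left_mono powr_mono2') auto
    finally show "norm ((-s) * w powr (-s-1)) \<le> norm s * x powr (-Re s - 1)" .
  qed (use t in auto)
  also have "\<dots> \<le> (norm s * x powr (-Re s - 1)) * N"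
  proof (intro mult_left_mono)
    obtain u where u: "t = of_real u" "u \<ge> x" "u \<le> x + N" using S t by blast
    have "t - of_real x = of_real (u - x)" using u by simp
    thus "norm (t - of_real x) \<le> N" using u by (simp only: norm_of_real)
  qed auto
  finally show ?thesis by (simp add: mult_ac)
qed

lemma norm_hurwitz_term_le:
  fixes s :: complex
  assumes x: "x > 0" and N: "N > 0" and s: "Re s > 0"
  shows "norm ((s - 1) * of_real x powr (-s) - (of_real x powr (1-s) - of_real (x + N) powr (1-s)) / of_real N)
         \<le> norm (s - 1) * norm s * N * x powr (-Re s - 1)"
proof -
  let ?S = "closed_segment (of_real x) (of_real (x + N)) :: complex set"
  \<comment> \<open>The increment of \<open>\<phi>\<close> over the segment is exactly the
    expression to be bounded, and its derivative contains the difference estimated in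
    \<open>norm_powr_diff_le\<close>. This gains the extra power of \<open>x\<close> that gives
    summability for \<open>Re s > 0\<close>.\<close>
  define \<phi> where "\<phi> = (\<lambda>t. ((s - 1) * of_real x powr (-s) * t + t powr (1-s)) / of_real N)"
  have S: "\<exists>u. w = of_real u \<and> u \<ge> x \<and> u \<le> x + N" if "w \<in> ?S" for w
    using of_real_in_closed_segment[of w x N] that N by simp
  have "norm (\<phi> (of_real (x + N)) - \<phi> (of_real x)) \<le>
     (norm (s - 1) * norm s * x powr (-Re s - 1)) * norm (of_real (x + N) - of_real x :: complex)"
  proof (rule field_differentiable_bound[where S = ?S])
    fix w assume w: "w \<in> ?S"
    then obtain u where u: "w = of_real u" "u \<ge> x" using S by blast
    have "w \<notin> \<real>\<^sub>\<le>\<^sub>0" using u x by auto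
    thus "(\<phi> has_field_derivative (1 - s) * (w powr (-s) - of_real x powr (-s)) / of_real N) (at w within ?S)"
      unfolding \<phi>_def using N
      by (auto intro!: derivative_eq_intros has_field_derivative_at_within[OF has_field_derivative_powr]
               simp: field_simps)
    have "norm ((1 - s) * (w powr (-s) - of_real x powr (-s)) / of_real N)
          = norm (s - 1) * norm (w powr (-s) - of_real x powr (-s)) / N"
      using N by (simp add: norm_mult norm_divide norm_minus_commute)
    also have "\<dots> \<le> norm (s - 1) * (norm s * N * x powr (-Re s - 1)) / N"
      using N by (intro divide_right_mono mult_left_mono norm_powr_diff_le x w s) auto
    finally show "norm ((1 - s) * (w powr (-s) - of_real x powr (-s)) / of_real N)
        \<le> norm (s - 1) * norm s * x powr (-Re s - 1)"
      using N by simp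
  qed auto
  also have "norm (of_real (x + N) - of_real x :: complex) = N"
    using N by (simp flip: of_real_diff)
  also have "\<phi> (of_real (x + N)) - \<phi> (of_real x) =
     (s - 1) * of_real x powr (-s) - (of_real x powr (1-s) - of_real (x + N) powr (1-s)) / of_real N"
    using N by (simp add: \<phi>_def field_simps)
  finally show ?thesis by (simp add: mult_ac)
qed

text \<open>\<open>Z\<close> extends \<open>(s - 1) \<Sum> x\<^sub>k\<^sup>-\<^sup>s\<close> for \<open>x\<^sub>k = k N + r\<close>: subtracting the telescoping
  terms \<open>(x\<^sub>k\<^sup>1\<^sup>-\<^sup>s - x\<^sub>k\<^sub>+\<^sub>1\<^sup>1\<^sup>-\<^sup>s) / N\<close> makes the series converge for \<open>Re s > 0\<close>.\<close>

lemma progression_zeta: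
  fixes N r :: nat
  assumes N: "N > 0" and r: "r > 0"
  obtains Z where "Z holomorphic_on {s. Re s > 0}" "Z 1 = 1 / of_nat N"
    "\<And>s. Re s > 1 \<Longrightarrow> (\<lambda>k. (s - 1) * of_nat (k * N + r) powr (-s)) sums Z s"
proof -
  let ?S = "{s::complex. Re s > 0}"
  define x where "x = (\<lambda>k. real (k * N + r))"
  define g where "g = (\<lambda>k (s::complex). (s - 1) * of_real (x k) powr (-s) - (of_real (x k) powr (1-s) - of_real (x (Suc k)) powr (1-s)) / of_nat N)"
  have x: "x k > 0" "x (Suc k) = x k + real N" "x k \<ge> real k" for k
  proof -
    have "k * N + r \<ge> k * 1 + 0" using N by (intro add_mono mult_mono) auto
    thus "x k \<ge> real k" unfolding x_def by linarith
    show "x k > 0" using r by (simp only: x_def of_nat_0_less_iff)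
  qed (simp add: x_def algebra_simps)
  have op: "open ?S" by (simp add: open_halfspace_Re_gt)
  have bound: "norm (g k s) \<le> norm (s - 1) * norm s * real N * x k powr (-Re s - 1)" if "Re s > 0" for k s
    using norm_hurwitz_term_le[of "x k" "real N" s] x[of k] N that by (simp add: g_def)
  have "\<exists>G G'. \<forall>s \<in> ?S. ((\<lambda>k. g k s) sums G s) \<and> ((\<lambda>k. deriv (g k) s) sums G' s) \<and>
          (G has_field_derivative G' s) (at s)"
  proof (rule series_and_derivative_comparison_local[OF op])
    show "(g k has_field_derivative deriv (g k) s) (at s)" for k s
    proof (rule holomorphic_derivI[of _ UNIV])
      show "g k holomorphic_on UNIV"
        unfolding g_def using x(1)[of k] x(1)[of "Suc k"] N
        by (auto intro!: holomorphic_intros)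
    qed auto
    fix s assume s: "s \<in> ?S"
    define d where "d = Re s / 2"
    define R where "R = norm s + d"
    have d: "d > 0" using s by (simp add: d_def)
    have "norm (g k y) \<le> (R + 1) * R * real N * real k powr (-d - 1)"
      if k: "k \<ge> 1" and y: "y \<in> ball s d \<inter> ?S" for k y
    proof -
      have "\<bar>Re (s - y)\<bar> \<le> norm (s - y)" by (rule abs_Re_le_cmod)
      also have sy: "\<dots> < d" using y by (simp add: dist_norm)
      finally have "\<bar>Re s - Re y\<bar> < d" by simp
      hence Re: "Re y > d" unfolding d_def by linarith
      have yR: "norm y \<le> R" "norm (y - 1) \<le> R + 1"
        using norm_triangle_ineq4[of s "s - y"] norm_triangle_ineq4[of y 1] sy by (auto simp: R_def)
      have "norm (g k y) \<le> norm (y - 1) * norm y * real N * x k powr (-Re y - 1)"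
        using Re d by (intro bound) auto
      also have "\<dots> \<le> (R + 1) * R * real N * real k powr (-d - 1)"
      proof (intro mult_mono)
        have "x k powr (-Re y - 1) \<le> real k powr (-Re y - 1)"
          using x[of k] k d Re by (intro powr_mono2') auto
        also have "\<dots> \<le> real k powr (-d - 1)"
          using k Re by (intro powr_mono) auto
        finally show "x k powr (-Re y - 1) \<le> real k powr (-d - 1)" .
      qed (use yR d in \<open>auto simp: R_def\<close>)
      finally show ?thesis .
    qed
    moreover have "summable (\<lambda>k. (R + 1) * R * real N * real k powr (-d - 1))"
      using d by (intro summable_mult) (simp add: summable_real_powr_iff)
    ultimately show "\<exists>d h. 0 < d \<and> summable h \<and> (\<forall>\<^sub>F n in sequentially. \<forall>y\<in>ball s d \<inter> ?S. norm (g n y) \<le> h n)"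
      using d unfolding eventually_sequentially
      by (intro exI[of _ d] exI[of _ "\<lambda>k. (R + 1) * R * real N * real k powr (-d - 1)"]) blast
  qed
  then obtain G G' where G: "\<And>s. Re s > 0 \<Longrightarrow> (\<lambda>k. g k s) sums G s"
    "\<And>s. Re s > 0 \<Longrightarrow> (G has_field_derivative G' s) (at s)"
    by auto
  \<comment> \<open>The telescoping part sums to its first term, with \<open>x 0 = r\<close>, once
    \<open>Re s > 1\<close>.\<close>
  define Z where "Z = (\<lambda>s. of_nat r powr (1 - s) / of_nat N + G s)"
  show ?thesis
  proof
    have "G holomorphic_on ?S"
      using G(2) op by (subst holomorphic_on_open) auto
    thus "Z holomorphic_on ?S"
      unfolding Z_def using r N by (intro holomorphic_intros) auto
    \<comment> \<open>At \<open>s = 1\<close> the factor \<open>s - 1\<close> vanishes and both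
      powers with exponent \<open>1 - s\<close> equal 1, so only the telescoped term contributes to
      \<open>Z 1\<close>.\<close>
    have "(\<lambda>k. g k 1) = (\<lambda>_. 0)"
      using x(1) by (auto simp: g_def fun_eq_iff) (metis less_irrefl)+
    with G(1)[of 1] have "G 1 = 0" by (simp add: sums_iff)
    thus "Z 1 = 1 / of_nat N" using r by (simp add: Z_def)
    fix s :: complex assume s: "Re s > 1"
    define p where "p = (\<lambda>k. of_real (x k) powr (1 - s) / (of_nat N :: complex))"
    have "(\<lambda>k. real k powr (1 - Re s)) \<longlonglongrightarrow> 0"
      using s by (intro tendsto_neg_powr filterlim_real_sequentially) auto
    moreover have "eventually (\<lambda>k. x k powr (1 - Re s) \<le> real k powr (1 - Re s)) sequentially"
      using eventually_gt_at_top[of 0]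
      by eventually_elim (use x s in \<open>auto intro!: powr_mono2'\<close>)
    ultimately have "(\<lambda>k. x k powr (1 - Re s)) \<longlonglongrightarrow> 0"
      using tendsto_sandwich[of "\<lambda>_. 0" "\<lambda>k. x k powr (1 - Re s)" sequentially "\<lambda>k. real k powr (1 - Re s)" 0]
      by simp
    hence "(\<lambda>k. norm (of_real (x k) powr (1 - s) :: complex)) \<longlonglongrightarrow> 0"
      using x(1) by (simp add: norm_powr_real)
    hence "(\<lambda>k. of_real (x k) powr (1 - s) :: complex) \<longlonglongrightarrow> 0"
      by (rule tendsto_norm_zero_cancel)
    hence "p \<longlonglongrightarrow> 0 / of_nat N"
      unfolding p_def using N by (intro tendsto_divide tendsto_const) auto
    hence "p \<longlonglongrightarrow> 0" by simp
    from telescope_sums'[OF this] have p: "(\<lambda>k. p k - p (Suc k)) sums p 0" by simp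
    have "(\<lambda>k. (p k - p (Suc k)) + g k s) sums (p 0 + G s)"
      using s by (intro sums_add p G) auto
    moreover have "p k - p (Suc k) + g k s = (s - 1) * of_nat (k * N + r) powr (-s)" for k
      by (simp add: p_def g_def x_def diff_divide_distrib)
    moreover have "p 0 + G s = Z s"
      by (simp add: p_def Z_def x_def)
    ultimately show "(\<lambda>k. (s - 1) * of_nat (k * N + r) powr (-s)) sums Z s" by simp
  qed
qed

text \<open>Splitting into residue classes reduces to \<open>progression_zeta\<close>. The value
  \<open>H 1\<close>, the mean of \<open>c\<close> over a period, is the residue of the Dirichlet
  series at 1.\<close>

lemma periodic_dseries_continuation:
  fixes N :: nat and c :: "nat \<Rightarrow> complex"
  assumes N: "N > 0" and per: "\<And>n. c (n + N) = c n"
  obtains H where "H holomorphic_on {s. Re s > 0}" "H 1 = (\<Sum>r<N. c r) / of_nat N"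
    "\<And>s. Re s > 1 \<Longrightarrow> H s = (s - 1) * dseries c s"
proof -
  have perk: "c (k * N + n) = c n" for k n
  proof (induction k)
    case (Suc k)
    show ?case using per[of "k * N + n"] Suc by (simp add: algebra_simps)
  qed simp
  have "\<exists>Z. Z holomorphic_on {s. Re s > 0} \<and> Z 1 = 1 / of_nat N \<and>
     (\<forall>s. Re s > 1 \<longrightarrow> (\<lambda>k. (s - 1) * of_nat (k * N + Suc r) powr (-s)) sums Z s)" for r
    by (rule progression_zeta[OF N, of "Suc r"]) auto
  then obtain Z where Z: "\<And>r. Z r holomorphic_on {s. Re s > 0}" "\<And>r. Z r 1 = 1 / of_nat N"
    "\<And>r s. Re s > 1 \<Longrightarrow> (\<lambda>k. (s - 1) * of_nat (k * N + Suc r) powr (-s)) sums Z r s"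
    by metis
  \<comment> \<open>The representatives run from 1 to \<open>N\<close>, since
    \<open>progression_zeta\<close> requires a positive first term; by periodicity the sum over a
    period is unchanged.\<close>
  define H where "H = (\<lambda>s. \<Sum>r<N. c (Suc r) * Z r s)"
  show ?thesis
  proof
    show "H holomorphic_on {s. Re s > 0}"
      unfolding H_def by (intro holomorphic_intros Z)
    have "(\<Sum>r<N. c (Suc r)) + c 0 = (\<Sum>r<N. c r) + c N"
      by (subst sum.lessThan_Suc [symmetric], subst sum.lessThan_Suc_shift) simp
    with per[of 0] have "(\<Sum>r<N. c (Suc r)) = (\<Sum>r<N. c r)" by simp
    thus "H 1 = (\<Sum>r<N. c r) / of_nat N"
      by (simp add: H_def Z flip: sum_divide_distrib)
    fix s :: complex assume s: "Re s > 1"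
    define M where "M = Max (norm ` c ` {..<N})"
    have "norm (c n) \<le> M" for n
    proof -
      have "c n = c (n mod N)" using perk[of "n div N" "n mod N"] by simp
      thus ?thesis unfolding M_def using N by (intro Max_ge) auto
    qed
    hence "(\<lambda>n. c n * of_nat n powr (-s)) sums dseries c s"
      by (intro dseries_sums abs_conv_bounded s)
    hence "(\<lambda>n. c (Suc n) * of_nat (Suc n) powr (-s)) sums dseries c s"
      by (subst sums_Suc_iff) simp
    from sums_group[OF this N]
    have "(\<lambda>k. \<Sum>n=k*N..<k*N+N. c (Suc n) * of_nat (Suc n) powr (-s)) sums dseries c s" .
    also have "(\<lambda>k. \<Sum>n=k*N..<k*N+N. c (Suc n) * of_nat (Suc n) powr (-s)) =
               (\<lambda>k. \<Sum>r<N. c (Suc r) * of_nat (k * N + Suc r) powr (-s))"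
    proof
      fix k
      have c_shift: "c (Suc (a - k * N)) = c (Suc a)" if "k * N \<le> a" for a
        using perk[of k "Suc (a - k * N)"] that by simp
      show "(\<Sum>n=k*N..<k*N+N. c (Suc n) * of_nat (Suc n) powr (-s)) =
             (\<Sum>r<N. c (Suc r) * of_nat (k * N + Suc r) powr (-s))"
        using c_shift
        by (intro sum.reindex_bij_witness[of _ "\<lambda>r. k * N + r" "\<lambda>n. n - k * N"]) auto
    qed
    finally have "(\<lambda>k. (s - 1) * (\<Sum>r<N. c (Suc r) * of_nat (k * N + Suc r) powr (-s))) sums ((s - 1) * dseries c s)"
      by (rule sums_mult)
    moreover have "(\<lambda>k. \<Sum>r<N. c (Suc r) * ((s - 1) * of_nat (k * N + Suc r) powr (-s))) sums H s"
      unfolding H_def by (intro sums_sum sums_mult Z s)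
    ultimately show "H s = (s - 1) * dseries c s"
      by (simp add: sum_distrib_left mult_ac sums_iff)
  qed
qed

section \<open>Nonvanishing at 1\<close>

text \<open>The term for \<open>n = 1\<close> is 1, and the rest has norm at most 3/4.\<close>

lemma dseries_nonzero:
  assumes bd: "\<And>n. norm (a n) \<le> 1" and 1: "a 1 = 1" and s: "Re s \<ge> 2"
  shows "dseries a s \<noteq> 0"
proof
  assume 0: "dseries a s = 0"
  let ?t = "\<lambda>n. a n * of_nat n powr (-s)"
  have "abs_conv a" using bd by (rule abs_conv_bounded)
  hence "?t sums 0" using dseries_sums[of a s] s 0 by simp
  hence "(\<lambda>n. ?t (n + 2)) sums (0 - (\<Sum>i<2. ?t i))"
    by (rule sums_split_initial_segment)
  hence *: "(\<lambda>n. ?t (n + 2)) sums (-1)" using 1 by (simp add: numeral_2_eq_2)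
  \<comment> \<open>The telescoping majorant of \<open>1 / (n + 2)\<^sup>2\<close> has sum 1, which
    is not small enough. Lowering its first term from 1/2 to the exact value 1/4 brings the sum down
    to 3/4.\<close>
  define b where "b = (\<lambda>n. (1 / real (Suc n) - 1 / real (Suc (Suc n))) - (if n = 0 then 1/4 else 0))"
  have "(\<lambda>n. 1 / real (Suc n)) \<longlonglongrightarrow> 0"
    using LIMSEQ_inverse_real_of_nat by (simp add: inverse_eq_divide)
  from telescope_sums'[OF this] have "b sums (1 - 1/4)"
    unfolding b_def by (intro sums_diff sums_single[of 0 "\<lambda>_. 1/4"]) simp
  have "norm (\<Sum>n. ?t (n + 2)) \<le> suminf b"
  proof (rule norm_suminf_le)
    fix n
    have "norm (?t (n + 2)) \<le> 1 * real (n + 2) powr (- Re s)"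
      unfolding norm_mult norm_nat_powr using bd by (intro mult_mono) auto
    also have "\<dots> \<le> real (n + 2) powr (-2)" using s by (simp add: powr_mono)
    also have "\<dots> = 1 / real (n + 2) ^ 2"
      by (simp add: powr_minus powr_realpow inverse_eq_divide flip: powr_numeral)
    also have "\<dots> \<le> b n"
    proof (cases "n = 0")
      case False
      have "1 / real (n + 2) ^ 2 \<le> 1 / (real (n + 1) * real (n + 2))"
        unfolding power2_eq_square by (intro divide_left_mono mult_right_mono) auto
      also have "\<dots> = b n" using False by (simp add: b_def field_simps)
      finally show ?thesis .
    qed (simp add: b_def)
    finally show "norm (?t (n + 2)) \<le> b n" .
  qed (use \<open>b sums (1 - 1/4)\<close> in \<open>simp add: sums_iff\<close>)
  moreover have "suminf b = 3/4" using \<open>b sums (1 - 1/4)\<close> by (simp add: sums_iff)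
  moreover have "(\<Sum>n. ?t (n + 2)) = -1" using * by (simp add: sums_iff)
  ultimately show False by simp
qed

section \<open>Comparison of Taylor coefficients through logarithmic derivatives\<close>

text \<open>If \<open>F' = - F G\<close> and \<open>(-1)\<^sup>k g k\<close> are the derivatives of \<open>G\<close> at a point, then
  \<open>(-1)\<^sup>k exp_coeff g k\<close> are those of \<open>F\<close> there, relative to the value of \<open>F\<close>.\<close>

function exp_coeff :: "(nat \<Rightarrow> real) \<Rightarrow> nat \<Rightarrow> real" where
  "exp_coeff g 0 = 1"
| "exp_coeff g (Suc n) = (\<Sum>i\<le>n. real (n choose i) * exp_coeff g i * g (n - i))"
  by pat_completeness auto
termination by (relation "Wellfounded.measure snd") auto

text \<open>The recursion is a polynomial in the \<open>g k\<close> with nonnegative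
  coefficients.\<close>

lemma exp_coeff_mono:
  assumes "\<And>k. 0 \<le> h k" "\<And>k. h k \<le> g k"
  shows "0 \<le> exp_coeff h k \<and> exp_coeff h k \<le> exp_coeff g k"
proof (induction k rule: less_induct)
  case (less k)
  show ?case
  proof (cases k)
    case (Suc n)
    have IH: "0 \<le> exp_coeff h i" "exp_coeff h i \<le> exp_coeff g i" "0 \<le> exp_coeff g i" if "i \<le> n" for i
      using less[of i] that Suc by auto
    show ?thesis unfolding Suc exp_coeff.simps using IH assms
      by (intro conjI sum_nonneg sum_mono mult_mono mult_nonneg_nonneg) auto
  qed auto
qed

text \<open>Leibniz's rule applied to \<open>F' = - F G\<close> reproduces the recursion of
  \<open>exp_coeff\<close>; the signs combine to \<open>(-1) ^ k\<close>.\<close>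

lemma higher_deriv_log_deriv:
  assumes S: "open S" "b \<in> S"
    and G: "G holomorphic_on S"
    and F': "\<And>s. s \<in> S \<Longrightarrow> (F has_field_derivative - (F s * G s)) (at s)"
    and g: "\<And>k. (deriv ^^ k) G b = (-1) ^ k * of_real (g k)"
  shows "(deriv ^^ k) F b = F b * (-1) ^ k * of_real (exp_coeff g k)"
proof (induction k rule: less_induct)
  case (less k)
  have F: "F holomorphic_on S" using F' S(1) by (subst holomorphic_on_open) auto
  show ?case
  proof (cases k)
    case (Suc n)
    have "(deriv ^^ k) F b = (deriv ^^ n) (deriv F) b"
      by (simp add: Suc funpow_swap1)
    also have "\<dots> = (deriv ^^ n) (\<lambda>s. - (F s * G s)) b"
      using S F G F' by (intro higher_deriv_transform_within_open[where S = S])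
        (auto intro!: holomorphic_deriv holomorphic_intros DERIV_imp_deriv)
    also have "\<dots> = - (\<Sum>i = 0..n. of_nat (n choose i) * (deriv ^^ i) F b * (deriv ^^ (n-i)) G b)"
      using S F G by (subst higher_deriv_uminus[where S = S])
         (auto intro!: holomorphic_intros simp: higher_deriv_mult[where S = S])
    also have "(\<Sum>i = 0..n. of_nat (n choose i) * (deriv ^^ i) F b * (deriv ^^ (n-i)) G b) =
       (\<Sum>i\<le>n. F b * (-1) ^ n * of_real (real (n choose i) * exp_coeff g i * g (n - i)))"
    proof (intro sum.cong)
      fix i assume i: "i \<in> {..n}"
      have "(-1) ^ i * (-1) ^ (n - i) = ((-1) ^ n :: complex)"
        using i by (simp flip: power_add)
      with i less[of i] Suc show "of_nat (n choose i) * (deriv ^^ i) F b * (deriv ^^ (n-i)) G b =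
          F b * (-1) ^ n * of_real (real (n choose i) * exp_coeff g i * g (n - i))"
        by (simp add: g mult_ac)
    qed auto
    finally show ?thesis
      unfolding sum_distrib_left [symmetric] of_real_sum [symmetric] by (simp add: Suc)
  qed auto
qed

text \<open>To the left of \<open>b\<close> the factors \<open>(-t) ^ k\<close> cancel the
  alternating signs of the derivatives, leaving power series in \<open>t\<close> with coefficients
  ordered by \<open>exp_coeff_mono\<close>. The differential equations are used only near
  \<open>b\<close>, whereas holomorphy on the ball carries the comparison out to radius
  \<open>R\<close>.\<close>

lemma log_deriv_compare:
  assumes S: "open S" "b \<in> S"
    and F': "\<And>s. s \<in> S \<Longrightarrow> (F has_field_derivative - (F s * G s)) (at s)"
    and E': "\<And>s. s \<in> S \<Longrightarrow> (E has_field_derivative - (E s * K s)) (at s)"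
    and GK: "G holomorphic_on S" "K holomorphic_on S"
    and g: "\<And>k. (deriv ^^ k) G b = (-1) ^ k * of_real (g k)"
    and h: "\<And>k. (deriv ^^ k) K b = (-1) ^ k * of_real (h k)"
    and hg: "\<And>k. 0 \<le> h k" "\<And>k. h k \<le> g k"
    and F: "F holomorphic_on ball b R" and E: "E holomorphic_on ball b R"
    and nz: "F b \<noteq> 0" "E b \<noteq> 0"
    and t: "0 \<le> t" "t < R"
  shows "norm (E (b - of_real t) / E b) \<le> norm (F (b - of_real t) / F b)"
proof -
  have taylor: "(\<lambda>k. exp_coeff g k / fact k * t ^ k) sums Re (F (b - of_real t) / F b) \<and>
                Im (F (b - of_real t) / F b) = 0"
    if F': "\<And>s. s \<in> S \<Longrightarrow> (F has_field_derivative - (F s * G s)) (at s)"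
    and G: "G holomorphic_on S" and g: "\<And>k. (deriv ^^ k) G b = (-1) ^ k * of_real (g k)"
    and F: "F holomorphic_on ball b R" and nz: "F b \<noteq> 0" for F G g
  proof -
    have "(\<lambda>k. (deriv ^^ k) F b / fact k * (b - of_real t - b) ^ k) sums F (b - of_real t)"
      using t by (intro holomorphic_power_series[OF F]) (simp add: dist_norm)
    hence "(\<lambda>k. (deriv ^^ k) F b / fact k * (b - of_real t - b) ^ k / F b) sums (F (b - of_real t) / F b)"
      by (rule sums_divide)
    also have "(\<lambda>k. (deriv ^^ k) F b / fact k * (b - of_real t - b) ^ k / F b) =
               (\<lambda>k. of_real (exp_coeff g k / fact k * t ^ k))"
    proof
      fix k
      have "(-1) ^ k * (b - of_real t - b) ^ k = of_real (t ^ k)"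
        by (simp flip: power_mult_distrib)
      thus "(deriv ^^ k) F b / fact k * (b - of_real t - b) ^ k / F b = of_real (exp_coeff g k / fact k * t ^ k)"
        using nz by (simp add: higher_deriv_log_deriv[OF S G F' g] field_simps)
    qed
    finally have "(\<lambda>k. complex_of_real (exp_coeff g k / fact k * t ^ k)) sums (F (b - of_real t) / F b)" .
    from sums_Re[OF this] sums_Im[OF this]
    have "(\<lambda>k. exp_coeff g k / fact k * t ^ k) sums Re (F (b - of_real t) / F b)"
      "(\<lambda>k. 0) sums Im (F (b - of_real t) / F b)"
      by (simp_all only: Re_complex_of_real Im_complex_of_real)
    thus ?thesis using sums_unique[of "\<lambda>_. 0"] by auto
  qed
  note TF = taylor[OF F' GK(1) g F nz(1)] and TE = taylor[OF E' GK(2) h E nz(2)]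
  have "0 \<le> exp_coeff h k / fact k * t ^ k"
    "exp_coeff h k / fact k * t ^ k \<le> exp_coeff g k / fact k * t ^ k" for k
    using exp_coeff_mono[of h g k] hg t by (auto intro!: mult_right_mono divide_right_mono)
  hence "0 \<le> Re (E (b - of_real t) / E b)"
    "Re (E (b - of_real t) / E b) \<le> Re (F (b - of_real t) / F b)"
    using sums_le[OF _ sums_zero conjunct1[OF TE]] sums_le[OF _ conjunct1[OF TE] conjunct1[OF TF]]
    by blast+
  moreover have "norm z = \<bar>Re z\<bar>" if "Im z = 0" for z using that by (simp add: cmod_def)
  ultimately show ?thesis using TE TF by simp
qed

lemma has_field_derivative_prod_log_deriv:
  fixes f g :: "'i \<Rightarrow> complex \<Rightarrow> complex"
  assumes "finite I" "\<And>i. i \<in> I \<Longrightarrow> (f i has_field_derivative - (f i s * g i s)) (at s)"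
  shows "((\<lambda>s. \<Prod>i\<in>I. f i s) has_field_derivative - ((\<Prod>i\<in>I. f i s) * (\<Sum>i\<in>I. g i s))) (at s)"
  using assms
proof (induction I rule: finite_induct)
  case (insert i I)
  have "((\<lambda>s. f i s * (\<Prod>i\<in>I. f i s)) has_field_derivative
          - (f i s * g i s) * (\<Prod>i\<in>I. f i s) + - ((\<Prod>i\<in>I. f i s) * (\<Sum>i\<in>I. g i s)) * f i s) (at s)"
    using insert by (intro DERIV_mult) auto
  with insert.hyps show ?case by (simp add: algebra_simps)
qed auto

section \<open>Continuation of the L-functions to the right half-plane\<close>

lemma holomorphic_divide_zero:
  assumes "H holomorphic_on S" "open S" "H a = 0"
  obtains K where "K holomorphic_on S" "\<And>s. s \<in> S \<Longrightarrow> s \<noteq> a \<Longrightarrow> K s = H s / (s - a)"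
proof
  let ?K = "\<lambda>s. if s = a then deriv H a else H s / (s - a)"
  show "?K holomorphic_on S"
    by (rule pole_theorem_open_0[OF assms(1,2), of a]) (use assms(3) in auto)
qed auto

lemma mangoldt_power: "k > 0 \<Longrightarrow> mangoldt (n ^ k) = mangoldt n"
  by (cases "n = 0") (simp add: zero_power, simp add: mangoldt_def primepow_power_iff_nat aprimedivisor_primepow_power)

lemma dchar_dseries_continuation:
  assumes "\<psi> \<in> dchars N" "\<psi> \<noteq> principal_dchar N" "N > 0"
  obtains K where "K holomorphic_on {s. Re s > 0}" "\<And>s. Re s > 1 \<Longrightarrow> K s = dseries \<psi> s"
proof -
  obtain H where H: "H holomorphic_on {s. Re s > 0}" "H 1 = (\<Sum>r<N. \<psi> r) / of_nat N"
    "\<And>s. Re s > 1 \<Longrightarrow> H s = (s - 1) * dseries \<psi> s"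
    using periodic_dseries_continuation[of N \<psi>] dchars_periodic[OF assms(1)] assms(3) by metis
  have "H 1 = 0" using H(2) sum_nonprincipal_dchar[OF assms] by simp
  then obtain K where K: "K holomorphic_on {s. Re s > 0}"
    "\<And>s. Re s > 0 \<Longrightarrow> s \<noteq> 1 \<Longrightarrow> K s = H s / (s - 1)"
    using holomorphic_divide_zero[OF H(1) open_halfspace_Re_gt, of 1] by auto
  have "K s = dseries \<psi> s" if "Re s > 1" for s
    using K(2)[of s] H(3)[of s] that by force
  with K(1) show ?thesis using that by blast
qed

lemma principal_dchar_dseries_continuation:
  assumes "N > 0"
  obtains H where "H holomorphic_on {s. Re s > 0}" "H 1 \<noteq> 0"
    "\<And>s. Re s > 1 \<Longrightarrow> H s = (s - 1) * dseries (principal_dchar N) s"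
proof -
  obtain H where H: "H holomorphic_on {s. Re s > 0}" "H 1 = (\<Sum>r<N. principal_dchar N r) / of_nat N"
    "\<And>s. Re s > 1 \<Longrightarrow> H s = (s - 1) * dseries (principal_dchar N) s"
    using periodic_dseries_continuation[of N "principal_dchar N"]
      dchars_periodic[OF principal_dchar_in_dchars] assms by metis
  have "(\<Sum>r<N. principal_dchar N r) = of_nat (card {r\<in>{..<N}. coprime r N})"
    by (simp add: principal_dchar_def sum.If_cases Int_def)
  \<comment> \<open>Reduction modulo \<open>N\<close> covers the case \<open>N = 1\<close>, where
    the unit residue is 0.\<close>
  moreover have "1 mod N \<in> {r\<in>{..<N}. coprime r N}" using assms by simp
  hence "card {r\<in>{..<N}. coprime r N} \<noteq> 0" by (subst card_0_eq) auto
  ultimately have "H 1 \<noteq> 0" using H(2) assms by simp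
  with H show ?thesis using that by blast
qed

text \<open>Used with \<open>r m = m ^ c\<close>: the terms of the smaller series are matched with
  those of the larger one at perfect powers.\<close>

lemma suminf_le_reindex:
  fixes f h :: "nat \<Rightarrow> real"
  assumes "summable f" "\<And>n. 0 \<le> f n" "inj r" "summable h" "\<And>m. h m \<le> f (r m)"
  shows "suminf h \<le> suminf f"
proof (rule suminf_le_const[OF assms(4)])
  fix M
  have "sum h {..<M} \<le> (\<Sum>m<M. f (r m))" by (intro sum_mono assms(5))
  also have "\<dots> = sum f (r ` {..<M})"
    by (subst sum.reindex) (use assms(3) in \<open>auto simp: inj_on_def\<close>)
  also have "\<dots> \<le> suminf f" by (intro sum_le_suminf assms(1)) (use assms(2) in auto)
  finally show "sum h {..<M} \<le> suminf f" .
qed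

lemma dseries_of_real:
  assumes "abs_conv (\<lambda>n. of_real (u n))" "x > 1"
  shows "dseries (\<lambda>n. of_real (u n)) (of_real x) = of_real (\<Sum>n. u n * real n powr (-x))"
    and "summable (\<lambda>n. u n * real n powr (-x))"
proof -
  have eq: "complex_of_nat n powr (- of_real x) = of_real (real n powr (-x))" for n
    using powr_of_real[of "real n" "-x"] by simp
  show "summable (\<lambda>n. u n * real n powr (-x))"
    by (rule summable_norm_cancel) (use assms in \<open>auto simp: abs_conv_def abs_mult\<close>)
  from summable_sums[OF this]
  have "(\<lambda>n. of_real (u n * real n powr (-x)) :: complex) sums of_real (\<Sum>n. u n * real n powr (-x))"
    by (rule sums_of_real)
  thus "dseries (\<lambda>n. of_real (u n)) (of_real x) = of_real (\<Sum>n. u n * real n powr (-x))"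
    by (simp add: dseries_def eq sums_iff)
qed

lemma higher_deriv_dseries_of_real:
  assumes ac: "abs_conv (\<lambda>n. of_real (u n))" and u: "\<And>n. u n \<ge> 0" and x: "x > 1"
  defines "d \<equiv> \<lambda>k n. u n * ln (real n) ^ k * real n powr (-x)"
  shows "(deriv ^^ k) (dseries (\<lambda>n. of_real (u n))) (of_real x) = (-1) ^ k * of_real (\<Sum>n. d k n)"
    and "summable (d k)" "d k n \<ge> 0"
proof -
  note * = higher_deriv_dseries[OF ac, of "of_real x" k]
  have ac': "abs_conv (\<lambda>n. of_real (u n * ln (real n) ^ k))"
    using *(2) x by simp
  show "summable (d k)" using dseries_of_real(2)[OF ac' x] by (simp add: d_def)
  show "(deriv ^^ k) (dseries (\<lambda>n. of_real (u n))) (of_real x) = (-1) ^ k * of_real (\<Sum>n. d k n)"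
    using *(1) x dseries_of_real(1)[OF ac' x] by (simp add: d_def)
  show "d k n \<ge> 0" using u by (cases "n = 0") (auto simp: d_def)
qed

theorem dchar_nonvanishing:
  assumes \<psi>: "\<psi> \<in> dchars N" "\<psi> \<noteq> principal_dchar N" and N: "N > 0"
    and K: "K holomorphic_on {s. Re s > 0}" "\<And>s. Re s > 1 \<Longrightarrow> K s = dseries \<psi> s"
  shows "K 1 \<noteq> 0"
proof
  assume K1: "K 1 = 0"
  let ?S = "{s. Re s > 1}" and ?P = "{s. Re s > 0}" and ?p = "principal_dchar N"
  define X where "X = dchars N"
  define c where "c = card X"
  define Y where "Y = X - {?p, \<psi>}"
  have fin: "finite X" using finite_dchars[OF N] by (simp add: X_def)
  have pX: "?p \<in> X" "\<psi> \<in> X" using \<psi> principal_dchar_in_dchars by (auto simp: X_def)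
  have c: "c > 0" using fin pX by (auto simp: c_def card_gt_0_iff)
  obtain J where J: "J holomorphic_on ?P" "\<And>s. Re s > 0 \<Longrightarrow> s \<noteq> 1 \<Longrightarrow> J s = K s / (s - 1)"
    using holomorphic_divide_zero[OF K(1) open_halfspace_Re_gt K1] by auto
  obtain H where H: "H holomorphic_on ?P" "H 1 \<noteq> 0" "\<And>s. Re s > 1 \<Longrightarrow> H s = (s - 1) * dseries ?p s"
    using principal_dchar_dseries_continuation[OF N] by blast
  have "\<exists>K. K holomorphic_on ?P \<and> (\<forall>s. Re s > 1 \<longrightarrow> K s = dseries \<phi> s)" if "\<phi> \<in> Y" for \<phi>
    using dchar_dseries_continuation[of \<phi> N] that N unfolding X_def Y_def by blast
  then obtain L where L: "\<And>\<phi>. \<phi> \<in> Y \<Longrightarrow> L \<phi> holomorphic_on ?P"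
    "\<And>\<phi> s. \<phi> \<in> Y \<Longrightarrow> Re s > 1 \<Longrightarrow> L \<phi> s = dseries \<phi> s"
    by metis
  \<comment> \<open>For \<open>Re s > 1\<close> the product \<open>H * J\<close> equals
    \<open>L(s, \<psi>\<^sub>0) L(s, \<psi>)\<close>: the factor \<open>s - 1\<close> in
    \<open>H\<close> removes the pole, and the assumed zero of \<open>K\<close> permits the
    compensating division in \<open>J\<close>.\<close>
  define F where "F = (\<lambda>s. H s * J s * (\<Prod>\<phi>\<in>Y. L \<phi> s))"
  define E where "E = (\<lambda>s. dseries ?p (of_nat c * s))"
  \<comment> \<open>By orthogonality \<open>\<alpha>\<close> gives the coefficients of
    \<open>- F'/F\<close>; \<open>\<beta>\<close> gives those of \<open>- L'/L\<close> for the
    principal character, from which \<open>Q\<close> arises by the scaling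
    \<open>s \<mapsto> c s\<close>.\<close>
  define \<alpha> where "\<alpha> = (\<lambda>n. (if [n = 1] (mod N) then real c else 0) * mangoldt n :: real)"
  define \<beta> where "\<beta> = (\<lambda>n. (if coprime n N then 1 else 0) * mangoldt n :: real)"
  define G where "G = dseries (\<lambda>n. of_real (\<alpha> n))"
  define Q where "Q = (\<lambda>s. of_nat c * dseries (\<lambda>n. of_real (\<beta> n)) (of_nat c * s))"
  have bd: "norm (\<phi> n) \<le> 1" if "\<phi> \<in> X" for \<phi> n using that norm_dchars_le N by (simp add: X_def)
  have mult: "\<phi> (m * n) = \<phi> m * \<phi> n" if "\<phi> \<in> X" for \<phi> m n using that dchars_mult by (simp add: X_def)
  have pos: "\<alpha> n \<ge> 0" "\<beta> n \<ge> 0" for n by (auto simp: \<alpha>_def \<beta>_def mangoldt_nonneg)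
  have \<alpha>_eq: "of_real (\<alpha> n) = (\<Sum>\<phi>\<in>X. \<phi> n * mangoldt n)" for n
    using sum_dchars[OF N, of n] by (simp add: \<alpha>_def X_def c_def flip: sum_distrib_right)
  have \<beta>_eq: "of_real (\<beta> n) = ?p n * mangoldt n" for n
    by (simp add: \<beta>_def principal_dchar_def)
  have ac_\<alpha>: "abs_conv (\<lambda>n. of_real (\<alpha> n))"
    unfolding \<alpha>_eq sum_distrib_right [symmetric]
  proof (rule abs_conv_mangoldt)
    show "norm (\<Sum>\<phi>\<in>X. \<phi> n) \<le> (\<Sum>\<phi>\<in>X. 1)" for n
      using bd by (intro sum_norm_le) auto
  qed
  have ac_\<beta>: "abs_conv (\<lambda>n. of_real (\<beta> n))"
    unfolding \<beta>_eq using bd pX by (intro abs_conv_mangoldt) auto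
  have Sc: "Re (of_nat c * s) > 1" if "Re s > 1 / real c" for s
    using that c by (simp add: field_simps)
  have c1: "1 / real c \<le> 1" using c by simp

  have F_eq: "F s = (\<Prod>\<phi>\<in>X. dseries \<phi> s)" if s: "Re s > 1" for s
  proof -
    have X: "X = insert ?p (insert \<psi> Y)" using pX by (auto simp: Y_def)
    have "(\<Prod>\<phi>\<in>X. dseries \<phi> s) = dseries ?p s * (dseries \<psi> s * (\<Prod>\<phi>\<in>Y. dseries \<phi> s))"
      unfolding X using fin \<psi> by (subst prod.insert prod.insert; auto simp: Y_def)+
    moreover have "s \<noteq> 1" "Re s > 0" using s by auto
    ultimately show ?thesis using s by (simp add: F_def H J K L field_simps)
  qed
  have F': "(F has_field_derivative - (F s * G s)) (at s)" if "s \<in> ?S" for s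
  proof -
    have s: "Re s > 1" using that by simp
    have "G s = (\<Sum>\<phi>\<in>X. dseries (\<lambda>n. \<phi> n * mangoldt n) s)"
      unfolding G_def \<alpha>_eq using bd s by (intro dseries_sum abs_conv_mangoldt) auto
    moreover have "((\<lambda>s. \<Prod>\<phi>\<in>X. dseries \<phi> s) has_field_derivative
        - ((\<Prod>\<phi>\<in>X. dseries \<phi> s) * (\<Sum>\<phi>\<in>X. dseries (\<lambda>n. \<phi> n * mangoldt n) s))) (at s)"
      using fin bd mult s
      by (intro has_field_derivative_prod_log_deriv has_field_derivative_dseries_mult) auto
    ultimately have "((\<lambda>s. \<Prod>\<phi>\<in>X. dseries \<phi> s) has_field_derivative - (F s * G s)) (at s)"
      using F_eq[OF s] by simp
    thus ?thesis
      by (rule has_field_derivative_transform_within_open[OF _ open_halfspace_Re_gt, of _ _ _ 1])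
         (use s F_eq in auto)
  qed
  have E': "(E has_field_derivative - (E s * Q s)) (at s)" if "Re s > 1 / real c" for s
  proof -
    have "(dseries ?p has_field_derivative - (dseries ?p (of_nat c * s) *
            dseries (\<lambda>n. ?p n * mangoldt n) (of_nat c * s))) (at (of_nat c * s))"
      using pX bd mult Sc[OF that] by (intro has_field_derivative_dseries_mult) auto
    moreover have "((\<lambda>s. of_nat c * s) has_field_derivative of_nat c) (at s)"
      by (auto intro!: derivative_eq_intros)
    ultimately have "(dseries ?p \<circ> (\<lambda>s. of_nat c * s) has_field_derivative
       (- (dseries ?p (of_nat c * s) * dseries (\<lambda>n. ?p n * mangoldt n) (of_nat c * s))) * of_nat c) (at s)"
      by (rule DERIV_chain)
    thus ?thesis by (simp add: E_def Q_def \<beta>_eq o_def mult_ac)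
  qed
  define g where "g = (\<lambda>k. \<Sum>n. \<alpha> n * ln (real n) ^ k * real n powr (-2))"
  define b where "b = (\<lambda>k. \<Sum>n. \<beta> n * ln (real n) ^ k * real n powr (- (2 * real c)))"
  \<comment> \<open>One factor \<open>c\<close> comes from \<open>Q\<close> and \<open>c ^ k\<close>
    from the chain rule.\<close>
  define h where "h = (\<lambda>k. real c ^ Suc k * b k)"
  have g: "(deriv ^^ k) G 2 = (-1) ^ k * of_real (g k)" for k
    using higher_deriv_dseries_of_real(1)[OF ac_\<alpha> pos(1), of 2 k] by (simp add: G_def g_def)
  have c2: "2 * real c > 1" using c by simp
  have hol_\<beta>: "dseries (\<lambda>n. of_real (\<beta> n)) holomorphic_on ?S" by (rule holomorphic_dseries[OF ac_\<beta>])
  have hol_\<beta>c: "(\<lambda>s. dseries (\<lambda>n. of_real (\<beta> n)) (of_nat c * s)) holomorphic_on ?S"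
    using Sc c1 by (intro holomorphic_on_compose_gen[OF _ hol_\<beta>, unfolded o_def] holomorphic_intros) force
  have h: "(deriv ^^ k) Q 2 = (-1) ^ k * of_real (h k)" for k
  proof -
    have "(deriv ^^ k) Q 2 = of_nat c * (deriv ^^ k) (\<lambda>s. dseries (\<lambda>n. of_real (\<beta> n)) (of_nat c * s)) 2"
      unfolding Q_def by (rule higher_deriv_cmult[OF hol_\<beta>c]) (auto simp: open_halfspace_Re_gt)
    also have "(deriv ^^ k) (\<lambda>s. dseries (\<lambda>n. of_real (\<beta> n)) (of_nat c * s)) 2 =
        of_nat c ^ k * (deriv ^^ k) (dseries (\<lambda>n. of_real (\<beta> n))) (of_nat c * 2)"
      by (rule higher_deriv_compose_linear[OF hol_\<beta>, of ?S])
         (use Sc c1 in \<open>force simp: open_halfspace_Re_gt\<close>)+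
    also have "of_nat c * 2 = (of_real (2 * real c) :: complex)" by simp
    also have "(deriv ^^ k) (dseries (\<lambda>n. of_real (\<beta> n))) \<dots> = (-1) ^ k * of_real (b k)"
      unfolding b_def by (rule higher_deriv_dseries_of_real(1)[OF ac_\<beta> pos(2) c2])
    finally show ?thesis by (simp add: h_def)
  qed
  have h0: "0 \<le> h k" for k
    using higher_deriv_dseries_of_real(2,3)[OF ac_\<beta> pos(2) c2, where k = k]
    unfolding h_def b_def by (intro mult_nonneg_nonneg[OF zero_le_power suminf_nonneg]) auto
  have hg: "h k \<le> g k" for k
  proof -
    note A = higher_deriv_dseries_of_real(2,3)[OF ac_\<alpha> pos(1), where x = 2 and k = k]
    note B = higher_deriv_dseries_of_real(2,3)[OF ac_\<beta> pos(2) c2, where k = k]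
    have "h k = (\<Sum>n. real c ^ Suc k * (\<beta> n * ln (real n) ^ k * real n powr (- (2 * real c))))"
      using B(1) unfolding h_def b_def by (rule suminf_mult [symmetric])
    also have "\<dots> \<le> g k"
      unfolding g_def
    \<comment> \<open>The term of \<open>Q\<close> at \<open>m\<close> lives at the integer
      \<open>m ^ c\<close>, because \<open>m\<close> to the power \<open>- c s\<close> is
      \<open>m ^ c\<close> to the power \<open>- s\<close>.\<close>
    proof (rule suminf_le_reindex[where r = "\<lambda>m. m ^ c"])
      show "inj (\<lambda>m::nat. m ^ c)" using c by (auto intro!: injI dest: power_eq_imp_eq_base)
      fix m :: nat
      show "real c ^ Suc k * (\<beta> m * ln (real m) ^ k * real m powr (- (2 * real c)))
        \<le> \<alpha> (m ^ c) * ln (real (m ^ c)) ^ k * real (m ^ c) powr (-2)"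
      proof (cases "coprime m N \<and> m > 0")
        case True
        have "\<phi> (m ^ c) = 1" if "\<phi> \<in> X" for \<phi>
          using dchars_power_card[of \<phi> N m] that True N by (simp add: X_def c_def)
        hence "(\<Sum>\<phi>\<in>X. \<phi> (m ^ c)) = (\<Sum>\<phi>\<in>X. 1)" by (intro sum.cong) auto
        hence "(\<Sum>\<phi>\<in>X. \<phi> (m ^ c)) = of_nat c" by (simp add: c_def)
        \<comment> \<open>Orthogonality read backwards: a nonzero character sum forces the
          congruence. Both coefficients then agree, since
          \<open>mangoldt (m ^ c) = mangoldt m\<close>.\<close>
        hence "[m ^ c = 1] (mod N)"
          using sum_dchars[OF N, of "m ^ c"] c by (auto simp: X_def c_def split: if_splits)
        hence "\<alpha> (m ^ c) = real c * \<beta> m"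
          using True c by (simp add: \<alpha>_def \<beta>_def mangoldt_power)
        moreover have "ln (real (m ^ c)) = real c * ln (real m)"
          using True by (simp add: ln_realpow)
        moreover have "real (m ^ c) powr (-2) = real m powr (- (2 * real c))"
          using True by (simp add: powr_powr mult.commute flip: powr_realpow)
        ultimately show ?thesis by (simp add: power_mult_distrib mult_ac)
      next
        case False
        hence z: "\<beta> m * ln (real m) ^ k * real m powr (- (2 * real c)) = 0" by (auto simp: \<beta>_def)
        show ?thesis unfolding z using A(2)[of "m ^ c"] by (simp only: mult_zero_right)
      qed
    qed (use A B in auto)
    finally show ?thesis .
  qed
  \<comment> \<open>The radius \<open>2 - 1 / c\<close> is that of the largest ball about 2 on which
    \<open>Re (c s) > 1\<close>; it reaches the pole of \<open>E\<close>.\<close>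
  have ballP: "Re s > 1 / real c" if "s \<in> ball 2 (2 - 1 / real c)" for s
  proof -
    have "\<bar>Re (2 - s)\<bar> \<le> norm (2 - s)" by (rule abs_Re_le_cmod)
    also have "\<dots> < 2 - 1 / real c" using that by (simp add: dist_norm)
    finally show ?thesis by auto
  qed
  have holF: "F holomorphic_on ?P"
    unfolding F_def by (intro holomorphic_intros H J L)
  have nz: "F 2 \<noteq> 0" "E 2 \<noteq> 0"
  proof -
    have "dseries \<phi> 2 \<noteq> 0" if "\<phi> \<in> X" for \<phi>
      using bd[OF that] dchars_1[of \<phi> N] that by (intro dseries_nonzero) (auto simp: X_def)
    thus "F 2 \<noteq> 0" using F_eq[of 2] fin by simp
    show "E 2 \<noteq> 0" unfolding E_def
      using bd[OF pX(1)] dchars_1[of ?p N] pX(1) c by (intro dseries_nonzero) (auto simp: X_def)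
  qed
  have compare: "norm (E (2 - of_real t) / E 2) \<le> norm (F (2 - of_real t) / F 2)"
    if "0 \<le> t" "t < 2 - 1 / real c" for t
  proof (rule log_deriv_compare[OF open_halfspace_Re_gt _ F' _ _ _ g h h0 hg])
    show "E holomorphic_on ball 2 (2 - 1 / real c)"
      using E' ballP by (subst holomorphic_on_open) blast+
    show "F holomorphic_on ball 2 (2 - 1 / real c)"
      by (rule holomorphic_on_subset[OF holF]) (use ballP c in \<open>force intro: less_trans[rotated]\<close>)
    show "G holomorphic_on ?S" unfolding G_def by (rule holomorphic_dseries[OF ac_\<alpha>])
    show "Q holomorphic_on ?S" unfolding Q_def by (intro holomorphic_intros hol_\<beta>c)
    show "(E has_field_derivative - (E s * Q s)) (at s)" if "s \<in> ?S" for s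
      using that c1 by (intro E') auto
  qed (use that nz in auto)
  define M where "M = norm (E 2) / norm (F 2)"
  \<comment> \<open>Multiplication by \<open>c x - 1\<close> turns \<open>E\<close> into the
    continuous function \<open>H (c x)\<close>.\<close>
  have "norm (H (of_nat c * of_real x)) \<le> (real c * x - 1) * (M * norm (F (of_real x)))"
    if x: "1 / real c < x" "x < 2" for x
  proof -
    have cx: "real c * x > 1" using x c by (simp add: field_simps)
    have "norm (E (of_real x) / E 2) \<le> norm (F (of_real x) / F 2)"
      using compare[of "2 - x"] x by simp
    hence "norm (E (of_real x)) \<le> M * norm (F (of_real x))"
      using nz by (simp add: M_def norm_divide field_simps)
    moreover have "H (of_nat c * of_real x) = of_real (real c * x - 1) * E (of_real x)"
      using H(3)[of "of_nat c * of_real x"] cx by (simp add: E_def)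
    ultimately show ?thesis using cx by (simp only: norm_mult norm_of_real) (simp add: mult_left_mono)
  qed
  moreover have "1 / real c < 2" using c1 by simp
  ultimately have ev: "eventually (\<lambda>x. norm (H (of_nat c * of_real x)) \<le>
      (real c * x - 1) * (M * norm (F (of_real x)))) (at_right (1 / real c))"
    using eventually_at_right[of "1 / real c" 2] by blast
  have "H field_differentiable (at 1)"
    by (rule holomorphic_on_imp_differentiable_at[OF H(1) open_halfspace_Re_gt]) simp
  hence "isCont H 1" by (rule field_differentiable_imp_continuous_at)
  have "F field_differentiable (at (of_real (1 / real c)))"
    by (rule holomorphic_on_imp_differentiable_at[OF holF open_halfspace_Re_gt]) (use c in simp)
  hence "isCont F (of_real (1 / real c))" by (rule field_differentiable_imp_continuous_at)
  hence "((\<lambda>x. (real c * x - 1) * (M * norm (F (of_real x)))) \<longlongrightarrow>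
      (real c * (1 / real c) - 1) * (M * norm (F (of_real (1 / real c))))) (at_right (1 / real c))"
    by (intro tendsto_intros isCont_tendsto_compose[of _ F])
  moreover have "((\<lambda>x. of_nat c * of_real x :: complex) \<longlongrightarrow> of_nat c * of_real (1 / real c)) (at_right (1 / real c))"
    by (intro tendsto_intros)
  hence "((\<lambda>x. of_nat c * of_real x :: complex) \<longlongrightarrow> 1) (at_right (1 / real c))"
    using c by simp
  hence "((\<lambda>x. norm (H (of_nat c * of_real x))) \<longlongrightarrow> norm (H 1)) (at_right (1 / real c))"
    by (intro tendsto_norm isCont_tendsto_compose[OF \<open>isCont H 1\<close>])
  \<comment> \<open>As \<open>x\<close> decreases to \<open>1 / c\<close>, the bound tends to 0
    because \<open>F\<close> stays finite there, which contradicts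
    \<open>H 1 \<noteq> 0\<close>.\<close>
  ultimately have "norm (H 1) \<le> (real c * (1 / real c) - 1) * (M * norm (F (of_real (1 / real c))))"
    using ev by (intro tendsto_le[of "at_right (1 / real c)"]) auto
  thus False using H(2) c by simp
qed

section \<open>Dirichlet's theorem\<close>

text \<open>The limit is the order of the pole at 1. In the principal case the expression is
  \<open>(H - (s - 1) H') / H\<close>; otherwise it is \<open>- (s - 1) K' / K\<close>, whose limit
  0 depends on \<open>dchar_nonvanishing\<close>.\<close>

lemma tendsto_dseries_mangoldt:
  assumes \<psi>: "\<psi> \<in> dchars N" and N: "N > 0"
  shows "((\<lambda>x. (of_real x - 1) * dseries (\<lambda>n. \<psi> n * mangoldt n) (of_real x)) \<longlongrightarrow>
           (if \<psi> = principal_dchar N then 1 else 0)) (at_right 1)"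
proof -
  let ?V = "dseries (\<lambda>n. \<psi> n * mangoldt n)" and ?P = "{s. Re s > 0}"
  have ev: "eventually (\<lambda>x::real. x > 1) (at_right 1)" by (simp add: eventually_at_right_less)
  have D: "(dseries \<psi> has_field_derivative - (dseries \<psi> s * ?V s)) (at s)" if "Re s > 1" for s
    using \<psi> N that by (intro has_field_derivative_dseries_mult dchars_mult norm_dchars_le)
  have lim_id: "((\<lambda>x. of_real x :: complex) \<longlongrightarrow> 1) (at_right 1)"
    using tendsto_of_real[OF tendsto_ident_at, of 1 "{1<..}"] by simp
  have lim: "((\<lambda>x. f (of_real x)) \<longlongrightarrow> f 1) (at_right 1)" if "f holomorphic_on ?P" for f :: "complex \<Rightarrow> complex"
  proof -
    have "f field_differentiable (at 1)"
      by (rule holomorphic_on_imp_differentiable_at[OF that open_halfspace_Re_gt]) simp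
    hence f: "isCont f 1" by (rule field_differentiable_imp_continuous_at)
    thus ?thesis using lim_id by (rule isCont_tendsto_compose)
  qed
  show ?thesis
  proof (cases "\<psi> = principal_dchar N")
    case True
    obtain H where H: "H holomorphic_on ?P" "H 1 \<noteq> 0" "\<And>s. Re s > 1 \<Longrightarrow> H s = (s - 1) * dseries \<psi> s"
      using principal_dchar_dseries_continuation[OF N] True by blast
    have dH: "deriv H s = dseries \<psi> s - H s * ?V s" if "Re s > 1" for s
    proof (rule DERIV_imp_deriv)
      have "((\<lambda>s. (s - 1) * dseries \<psi> s) has_field_derivative dseries \<psi> s - H s * ?V s) (at s)"
        using D[OF that] by (auto intro!: derivative_eq_intros simp: H(3)[OF that] algebra_simps)
      thus "(H has_field_derivative dseries \<psi> s - H s * ?V s) (at s)"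
        by (rule has_field_derivative_transform_within_open[OF _ open_halfspace_Re_gt, of _ _ _ 1])
           (use that H(3) in auto)
    qed
    have "((\<lambda>x. (H (of_real x) - (of_real x - 1) * deriv H (of_real x)) / H (of_real x)) \<longlongrightarrow>
           (H 1 - (1 - 1) * deriv H 1) / H 1) (at_right 1)"
      by (intro tendsto_intros lim_id lim[OF H(1)] lim[OF holomorphic_deriv[OF H(1) open_halfspace_Re_gt]] H(2))
    hence "((\<lambda>x. (H (of_real x) - (of_real x - 1) * deriv H (of_real x)) / H (of_real x)) \<longlongrightarrow> 1) (at_right 1)"
      using H(2) by simp
    moreover have "eventually (\<lambda>x. H (of_real x) \<noteq> 0) (at_right 1)"
      using tendsto_imp_eventually_ne[OF lim[OF H(1)] H(2)] .
    hence "eventually (\<lambda>x. (H (of_real x) - (of_real x - 1) * deriv H (of_real x)) / H (of_real x) =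
             (of_real x - 1) * ?V (of_real x)) (at_right 1)"
      using ev
    proof eventually_elim
      case (elim x)
      have "H (of_real x) - (of_real x - 1) * deriv H (of_real x) =
            H (of_real x) * ((of_real x - 1) * ?V (of_real x))"
        using elim by (simp add: dH H(3)) (simp add: algebra_simps)
      thus ?case using elim by simp
    qed
    ultimately show ?thesis using True by (simp add: tendsto_cong)
  next
    case False
    obtain K where K: "K holomorphic_on ?P" "\<And>s. Re s > 1 \<Longrightarrow> K s = dseries \<psi> s"
      using dchar_dseries_continuation[OF \<psi> False N] by blast
    have K1: "K 1 \<noteq> 0" by (rule dchar_nonvanishing[OF \<psi> False N K])
    have dK: "deriv K s = - (K s * ?V s)" if "Re s > 1" for s
    proof (rule DERIV_imp_deriv)
      have "(dseries \<psi> has_field_derivative - (K s * ?V s)) (at s)"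
        using D[OF that] by (simp add: K(2)[OF that])
      thus "(K has_field_derivative - (K s * ?V s)) (at s)"
        by (rule has_field_derivative_transform_within_open[OF _ open_halfspace_Re_gt, of _ _ _ 1])
           (use that K(2) in auto)
    qed
    have "((\<lambda>x. (of_real x - 1) * - deriv K (of_real x) / K (of_real x)) \<longlongrightarrow>
           (1 - 1) * - deriv K 1 / K 1) (at_right 1)"
      by (intro tendsto_intros lim_id lim[OF K(1)] lim[OF holomorphic_deriv[OF K(1) open_halfspace_Re_gt]] K1)
    hence "((\<lambda>x. (of_real x - 1) * - deriv K (of_real x) / K (of_real x)) \<longlongrightarrow> 0) (at_right 1)"
      by simp
    moreover have "eventually (\<lambda>x. K (of_real x) \<noteq> 0) (at_right 1)"
      using tendsto_imp_eventually_ne[OF lim[OF K(1)] K1] .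
    hence "eventually (\<lambda>x. (of_real x - 1) * - deriv K (of_real x) / K (of_real x) =
             (of_real x - 1) * ?V (of_real x)) (at_right 1)"
      using ev by eventually_elim (simp add: dK)
    ultimately show ?thesis using False by (simp add: tendsto_cong)
  qed
qed

text \<open>Only proper prime powers contribute, and the term at \<open>p ^ (j + 2)\<close> is at
  most \<open>ln p / p\<^sup>2\<close> times \<open>(1/2) ^ j\<close>; the double series of these
  bounds is a product of convergent series.\<close>

lemma summable_mangoldt_nonprime:
  "summable (\<lambda>n. if prime n then 0 else mangoldt n / real n)"
proof -
  define f where "f = (\<lambda>n. if prime n then 0 else mangoldt n / real n)"
  define q where "q = (\<lambda>(p, j). p ^ (j + 2) :: nat)"
  let ?A = "{p::nat. prime p} \<times> (UNIV :: nat set)"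
  have "abs_conv (\<lambda>n. 1 * of_real (ln (real n)))" by (intro abs_conv_ln abs_conv_bounded[of _ 1]) auto
  hence "1 < (2::real) \<longrightarrow> summable (\<lambda>n. norm (1 * complex_of_real (ln (real n))) * real n powr (-2))"
    unfolding abs_conv_def by (rule spec)
  hence "summable (\<lambda>p. norm (\<bar>ln (real p)\<bar> * real p powr (-2)))"
    by (simp add: abs_mult)
  hence "(\<lambda>p. norm (\<bar>ln (real p)\<bar> * real p powr (-2))) summable_on UNIV"
    by (rule summable_nonneg_imp_summable_on) simp
  hence 1: "(\<lambda>p. norm (\<bar>ln (real p)\<bar> * real p powr (-2))) summable_on {p. prime p}"
    by (rule summable_on_subset_banach) simp
  have 2: "(\<lambda>j. norm ((1 / 2 :: real) ^ j)) summable_on UNIV"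
    by (intro summable_nonneg_imp_summable_on) (auto intro!: summable_geometric)
  have "(\<lambda>(p, j). \<bar>ln (real p)\<bar> * real p powr (-2) * (1 / 2) ^ j) summable_on ?A"
    using has_sum_times[OF 1 2 has_sum_infsum[OF abs_summable_summable[OF 1]] has_sum_infsum[OF abs_summable_summable[OF 2]]]
    by (rule has_sum_imp_summable)
  hence "(\<lambda>x. f (q x)) summable_on ?A"
  proof (rule summable_on_comparison_test)
    fix x assume "x \<in> ?A"
    then obtain p j where x: "x = (p, j)" and p: "prime p" by auto
    have p2: "real p \<ge> 2" using prime_ge_2_nat[OF p] by simp
    have "\<not> prime (p ^ (j + 2))" by (subst prime_power_iff) simp
    hence "f (q x) = mangoldt (p ^ (j + 2)) / real (p ^ (j + 2))"
      by (simp only: f_def q_def x prod.case if_False)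
    also have "mangoldt (p ^ (j + 2)) = ln (real p)" using p by (subst mangoldt_primepow) auto
    also have "real (p ^ (j + 2)) = real p ^ 2 * real p ^ j" by (simp add: power2_eq_square)
    finally have "f (q x) = ln (real p) / (real p ^ 2 * real p ^ j)" .
    also have "\<dots> \<le> ln (real p) / (real p ^ 2 * 2 ^ j)"
      using p2 by (intro divide_left_mono mult_left_mono power_mono) auto
    also have "\<dots> = \<bar>ln (real p)\<bar> * real p powr (-2) * (1 / 2) ^ j"
      using p2 by (simp add: powr_minus powr_realpow field_simps flip: powr_numeral)
    finally show "f (q x) \<le> (case x of (p, j) \<Rightarrow> \<bar>ln (real p)\<bar> * real p powr (-2) * (1 / 2) ^ j)"
      by (simp add: x)
    show "0 \<le> f (q x)" by (simp add: f_def mangoldt_nonneg)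
  qed
  moreover have "inj_on q ?A"
  proof (rule inj_onI)
    fix x y assume xy: "x \<in> ?A" "y \<in> ?A" "q x = q y"
    obtain p j p' j' where x: "x = (p, j)" and y: "y = (p', j')" by fastforce
    have "p = p' \<and> j + 2 = j' + 2"
      using prime_power_inj'[of p p' "j + 2" "j' + 2"] xy by (simp add: x y q_def)
    thus "x = y" by (simp add: x y)
  qed
  ultimately have "f summable_on (q ` ?A)"
    by (subst summable_on_reindex) (auto simp: o_def)
  moreover have "f n = 0" if "n \<notin> q ` ?A" for n
  proof (rule ccontr)
    assume "f n \<noteq> 0"
    hence "\<not> prime n" "primepow n" by (auto simp: f_def mangoldt_def split: if_splits)
    then obtain p k where pk: "prime p" "k > 0" "n = p ^ k" by (auto simp: primepow_def)
    hence "k \<noteq> 1" using \<open>\<not> prime n\<close> by auto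
    hence "k - 2 + 2 = k" using pk(2) by simp
    hence "n = q (p, k - 2)" by (simp only: q_def prod.case pk(3))
    with pk(1) that show False by blast
  qed
  ultimately have "f summable_on UNIV"
    by (subst summable_on_cong_neutral[of "q ` ?A" UNIV f f]) auto
  thus ?thesis unfolding f_def by (rule summable_on_imp_summable)
qed

text \<open>If only finitely many primes lay in the progression, \<open>mangoldt n / n\<close> would
  be summable along it, and the weighted series \<open>W\<close> would tend to 0 at 1. Its limit,
  computed character by character, is 1.\<close>

theorem dirichlet_primes_in_progression:
  fixes b N :: nat
  assumes N: "N > 0" and b: "coprime b N"
  shows "infinite {p. prime p \<and> [p = b] (mod N)}"
proof
  assume fin: "finite {p. prime p \<and> [p = b] (mod N)}"
  \<comment> \<open>The weights \<open>\<psi> b'\<close> play the role of the conjugates of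
    \<open>\<psi> b\<close> in the orthogonality relation.\<close>
  obtain b' where b': "[b * b' = 1] (mod N)"
    using cong_solve_coprime_nat[OF b] by auto
  hence cop: "coprime b' N"
    using cong_imp_coprime[OF cong_sym[OF b']] by simp
  define c where "c = real (card (dchars N))"
  define a where "a = (\<lambda>n. (if [n = b] (mod N) then of_real c else 0) * mangoldt n :: complex)"
  define u where "u = (\<lambda>n. if [n = b] (mod N) then mangoldt n / real n else 0 :: real)"
  have u0: "u n \<ge> 0" for n by (simp add: u_def mangoldt_nonneg)
  \<comment> \<open>Finitely many primes and all proper prime powers together majorize
    \<open>u\<close>.\<close>
  have "summable (\<lambda>n. (if n \<in> {p. prime p \<and> [p = b] (mod N)} then u n else 0) +
           (if prime n then 0 else mangoldt n / real n))"
    by (intro summable_add summable_mangoldt_nonprime summable_If_finite_set fin)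
  hence su: "summable u"
    by (rule summable_comparison_test'[where N = 0]) (auto simp: u_def mangoldt_nonneg)
  have cong_iff: "[b' * n = 1] (mod N) \<longleftrightarrow> [n = b] (mod N)" for n
  proof
    assume "[n = b] (mod N)"
    hence "[b' * n = b' * b] (mod N)" by (intro cong_mult) auto
    with b' show "[b' * n = 1] (mod N)" by (metis cong_trans mult.commute)
  next
    assume "[b' * n = 1] (mod N)"
    hence "[b' * n = b' * b] (mod N)" using b' by (metis cong_sym cong_trans mult.commute)
    thus "[n = b] (mod N)" using cop by (simp add: cong_mult_lcancel_nat)
  qed
  have a_eq: "(\<Sum>\<psi>\<in>dchars N. \<psi> b' * (\<psi> n * mangoldt n)) = a n" for n
  proof -
    have "(\<Sum>\<psi>\<in>dchars N. \<psi> b' * (\<psi> n * mangoldt n)) = (\<Sum>\<psi>\<in>dchars N. \<psi> (b' * n)) * mangoldt n"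
      by (simp add: sum_distrib_right dchars_mult mult.assoc)
    thus ?thesis unfolding sum_dchars[OF N] cong_iff by (simp add: a_def c_def)
  qed
  define W where "W = (\<lambda>x. (\<Sum>\<psi>\<in>dchars N. \<psi> b' * ((of_real x - 1) * dseries (\<lambda>n. \<psi> n * mangoldt n) (of_real x))))"
  have "(W \<longlongrightarrow> (\<Sum>\<psi>\<in>dchars N. \<psi> b' * (if \<psi> = principal_dchar N then 1 else 0))) (at_right 1)"
    unfolding W_def by (intro tendsto_sum tendsto_mult_left tendsto_dseries_mangoldt N)
  also have "(\<Sum>\<psi>\<in>dchars N. \<psi> b' * (if \<psi> = principal_dchar N then 1 else 0)) = (\<Sum>\<psi>\<in>{principal_dchar N}. \<psi> b')"
    using finite_dchars[OF N] principal_dchar_in_dchars by (intro sum.mono_neutral_cong_right) auto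
  also have "\<dots> = 1" using cop by (simp add: principal_dchar_def)
  finally have W1: "(W \<longlongrightarrow> 1) (at_right 1)" .
  \<comment> \<open>Since \<open>x > 1\<close>, the factor \<open>n powr (-x)\<close> is at most
    \<open>1 / n\<close>, so the series is bounded uniformly in \<open>x\<close>.\<close>
  have W_le: "norm (W x) \<le> (x - 1) * (c * suminf u)" if x: "x > 1" for x
  proof -
    have ac: "abs_conv (\<lambda>n. \<psi> n * mangoldt n)" if "\<psi> \<in> dchars N" for \<psi>
      using norm_dchars_le[OF that N] by (rule abs_conv_mangoldt)
    have ac': "abs_conv (\<lambda>n. \<psi> b' * (\<psi> n * mangoldt n))" if "\<psi> \<in> dchars N" for \<psi>
      using ac[OF that] by (rule abs_conv_mult_bounded[where C = "norm (\<psi> b')"]) (simp add: norm_mult)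
    have "W x = (of_real x - 1) * (\<Sum>\<psi>\<in>dchars N. \<psi> b' * dseries (\<lambda>n. \<psi> n * mangoldt n) (of_real x))"
      by (simp add: W_def sum_distrib_left mult_ac)
    also have "(\<Sum>\<psi>\<in>dchars N. \<psi> b' * dseries (\<lambda>n. \<psi> n * mangoldt n) (of_real x)) =
        (\<Sum>\<psi>\<in>dchars N. dseries (\<lambda>n. \<psi> b' * (\<psi> n * mangoldt n)) (of_real x))"
      using x by (intro sum.cong) (auto simp: dseries_cmult[OF ac])
    also have "\<dots> = dseries a (of_real x)"
      using x ac' by (subst dseries_sum [symmetric]) (auto simp: a_eq)
    also have "of_real x - 1 = complex_of_real (x - 1)" by simp
    finally have "norm (W x) = (x - 1) * norm (dseries a (of_real x))"
      using x by (simp only: norm_mult norm_of_real)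
    also have "norm (dseries a (of_real x)) \<le> (\<Sum>n. c * u n)"
      unfolding dseries_def
    proof (rule norm_suminf_le)
      fix n :: nat
      show "norm (a n * of_nat n powr (- of_real x)) \<le> c * u n"
      proof (cases "n > 0 \<and> [n = b] (mod N)")
        case True
        have "norm (a n * of_nat n powr (- of_real x)) = c * (mangoldt n * real n powr (-x))"
          using True by (simp add: a_def norm_mult norm_nat_powr c_def)
        also have "real n powr (-x) \<le> real n powr (-1)"
          using True x by (intro powr_mono) auto
        hence "c * (mangoldt n * real n powr (-x)) \<le> c * (mangoldt n * real n powr (-1))"
          by (intro mult_left_mono) (auto simp: c_def mangoldt_nonneg)
        also have "\<dots> = c * u n" using True by (simp add: u_def powr_minus field_simps)
        finally show ?thesis .
      next
        case False
        thus ?thesis using u0 by (auto simp: a_def c_def)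
      qed
    qed (intro summable_mult su)
    also have "(\<Sum>n. c * u n) = c * suminf u" by (rule suminf_mult[OF su])
    finally show ?thesis using x by (simp add: mult_left_mono)
  qed
  have "((\<lambda>x. (x - 1) * (c * suminf u)) \<longlongrightarrow> (1 - 1) * (c * suminf u)) (at_right 1)"
    by (intro tendsto_intros)
  moreover have "eventually (\<lambda>x. norm (W x) \<le> (x - 1) * (c * suminf u)) (at_right 1)"
    using eventually_at_right_less[of 1] by eventually_elim (rule W_le)
  ultimately have "norm (1::complex) \<le> (1 - 1) * (c * suminf u)"
    using tendsto_norm[OF W1] by (intro tendsto_le[of "at_right (1::real)"]) auto
  thus False by simp
qed

section \<open>Covering systems\<close>

lemma compositeI: "q dvd n \<Longrightarrow> 1 < q \<Longrightarrow> q < n \<Longrightarrow> composite n"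
  unfolding composite_def by (metis less_trans nat_neq_iff prime_nat_iff)

text \<open>Modulo \<open>q\<close> the progression is constant and powers of 10 have period
  \<open>T\<close>, so the residue depends only on \<open>d mod T\<close>.\<close>

lemma dvd_power_10_progression:
  fixes q A B T d m j :: nat
  assumes "A mod q = 0" "[10 ^ T = 1] (mod q)" "d mod T = r" "(10 ^ r * B + j) mod q = 0"
  shows "q dvd 10 ^ d * (A * m + B) + j"
proof -
  have "d = T * (d div T) + r" using assms(3) by auto
  hence "10 ^ d = (10 :: nat) ^ (T * (d div T) + r)" by (rule arg_cong)
  also have "\<dots> = (10 ^ T) ^ (d div T) * 10 ^ r" by (simp add: power_add power_mult)
  also have "[\<dots> = 1 ^ (d div T) * 10 ^ r] (mod q)"
    by (intro cong_mult cong_pow assms cong_refl)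
  finally have pow: "[10 ^ d = 10 ^ r] (mod q)" by simp
  have lin: "[A * m + B = 0 * m + B] (mod q)"
    by (intro cong_add cong_mult cong_refl) (use assms(1) in \<open>simp add: cong_def\<close>)
  have "[10 ^ d * (A * m + B) + j = 10 ^ r * (0 * m + B) + j] (mod q)"
    by (rule cong_add[OF cong_mult[OF pow lin] cong_refl])
  thus ?thesis using assms(4) by (simp add: cong_dvd_iff mod_eq_0_iff_dvd)
qed

lemma composite_power_10_progression:
  fixes q A B T d m j :: nat
  assumes "A mod q = 0" "[10 ^ T = 1] (mod q)" "d mod T = r" "(10 ^ r * B + j) mod q = 0" "1 < q" "q < B"
  shows "composite (10 ^ d * (A * m + B) + j)"
proof (rule compositeI)
  have "1 * B \<le> 10 ^ d * (A * m + B)" by (intro mult_mono) auto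
  thus "q < 10 ^ d * (A * m + B) + j" using assms(6) by simp
qed (use dvd_power_10_progression[OF assms(1-4)] assms(5) in auto)

text \<open>The product of 2, 3, 5 and all the primes \<open>q\<close> of the two covering systems
  below. The companion \<open>progression_residue\<close> solves the resulting congruences in the
  manner of the Chinese remainder theorem.\<close>

definition progression_modulus :: nat where "progression_modulus = 124703827160493827160493827160493827160493827160493827035790"
definition progression_residue :: nat where "progression_residue = 41459060189171787548442999328384678040412832671445258454633"

text \<open>Repeated splitting of classes modulo 3, 9, 27 and 54, with two classes halved modulo 6
  and 18. Each modulus occurs as often as \<open>composite_ending_9\<close> has a prime modulo which
  10 has that order.\<close>

lemma covering_9:
  fixes d :: nat
  shows "d mod 3 = 1 \<or> d mod 6 = 2 \<or> d mod 6 = 5 \<or> d mod 18 = 3 \<or> d mod 18 = 12 \<or> d mod 9 = 6 \<or>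
    d mod 27 = 9 \<or> d mod 27 = 18 \<or> d mod 54 = 0 \<or> d mod 54 = 27"
proof -
  have "d mod 3 = 1 \<or> d mod 6 = 2 \<or> d mod 6 = 5 \<or> d mod 3 = 0" by presburger
  moreover have "d mod 18 = 3 \<or> d mod 18 = 12 \<or> d mod 9 = 6 \<or> d mod 9 = 0" if h: "d mod 3 = 0"
  proof -
    obtain k where "d = 3 * k" using mod_0_imp_dvd[OF h] by blast
    moreover have "k mod 6 = 1 \<or> k mod 6 = 4 \<or> k mod 3 = 2 \<or> k mod 3 = 0" by presburger
    \<comment> \<open>Residues of \<open>k\<close> modulo 6 and 3 scale to residues of
      \<open>3 k\<close> modulo 18 and 9.\<close>
    ultimately show ?thesis using mult_mod_right[of 3 k 6] mult_mod_right[of 3 k 3] by auto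
  qed
  moreover have "d mod 27 = 9 \<or> d mod 27 = 18 \<or> d mod 27 = 0" if h: "d mod 9 = 0"
  proof -
    obtain k where "d = 9 * k" using mod_0_imp_dvd[OF h] by blast
    moreover have "k mod 3 = 1 \<or> k mod 3 = 2 \<or> k mod 3 = 0" by presburger
    ultimately show ?thesis using mult_mod_right[of 9 k 3] by auto
  qed
  moreover have "d mod 54 = 0 \<or> d mod 54 = 27" if h: "d mod 27 = 0"
  proof -
    obtain k where "d = 27 * k" using mod_0_imp_dvd[OF h] by blast
    moreover have "k mod 2 = 0 \<or> k mod 2 = 1" by presburger
    ultimately show ?thesis using mult_mod_right[of 27 k 2] by auto
  qed
  ultimately show ?thesis by metis
qed

lemma composite_ending_9:
  "composite (10 ^ d * (progression_modulus * m + progression_residue) + 9)"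
proof -
  \<comment> \<open>In each class, numeral evaluation confirms that \<open>q\<close> divides the
    modulus of the progression, that \<open>10 ^ T\<close> is 1 modulo \<open>q\<close>, and that
    \<open>10 ^ r * B + 9\<close> vanishes modulo \<open>q\<close>.\<close>
  note c = composite_power_10_progression[where A = progression_modulus and B = progression_residue and j = 9 and d = d and m = m]
  show ?thesis
    using covering_9[of d]
    apply (elim disjE)
    subgoal by (erule c[where q = 37 and T = 3 and r = 1, rotated 2]) (simp_all add: progression_modulus_def progression_residue_def cong_def del: One_nat_def)
    subgoal by (erule c[where q = 13 and T = 6 and r = 2, rotated 2]) (simp_all add: progression_modulus_def progression_residue_def cong_def del: One_nat_def)
    subgoal by (erule c[where q = 7 and T = 6 and r = 5, rotated 2]) (simp_all add: progression_modulus_def progression_residue_def cong_def del: One_nat_def)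
    subgoal by (erule c[where q = 19 and T = 18 and r = 3, rotated 2]) (simp_all add: progression_modulus_def progression_residue_def cong_def del: One_nat_def)
    subgoal by (erule c[where q = 52579 and T = 18 and r = 12, rotated 2]) (simp_all add: progression_modulus_def progression_residue_def cong_def del: One_nat_def)
    subgoal by (erule c[where q = 333667 and T = 9 and r = 6, rotated 2]) (simp_all add: progression_modulus_def progression_residue_def cong_def del: One_nat_def)
    subgoal by (erule c[where q = 757 and T = 27 and r = 9, rotated 2]) (simp_all add: progression_modulus_def progression_residue_def cong_def del: One_nat_def)
    subgoal by (erule c[where q = 440334654777631 and T = 27 and r = 18, rotated 2]) (simp_all add: progression_modulus_def progression_residue_def cong_def del: One_nat_def)
    subgoal by (erule c[where q = 70541929 and T = 54 and r = 0, rotated 2]) (simp_all add: progression_modulus_def progression_residue_def cong_def del: One_nat_def)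
    subgoal by (erule c[where q = 14175966169 and T = 54 and r = 27, rotated 2]) (simp_all add: progression_modulus_def progression_residue_def cong_def del: One_nat_def)
    done
qed

lemma composite_ending_3:
  "composite (10 ^ d * (progression_modulus * m + progression_residue) + 3)"
proof -
  note c = composite_power_10_progression[where A = progression_modulus and B = progression_residue and j = 3 and d = d and m = m]
  have "d mod 2 = 1 \<or> d mod 4 = 2 \<or> d mod 8 = 0 \<or> d mod 8 = 4" by presburger
  thus ?thesis
    apply (elim disjE)
    subgoal by (erule c[where q = 11 and T = 2 and r = 1, rotated 2]) (simp_all add: progression_modulus_def progression_residue_def cong_def del: One_nat_def)
    subgoal by (erule c[where q = 101 and T = 4 and r = 2, rotated 2]) (simp_all add: progression_modulus_def progression_residue_def cong_def del: One_nat_def)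
    subgoal by (erule c[where q = 137 and T = 8 and r = 0, rotated 2]) (simp_all add: progression_modulus_def progression_residue_def cong_def del: One_nat_def)
    subgoal by (erule c[where q = 73 and T = 8 and r = 4, rotated 2]) (simp_all add: progression_modulus_def progression_residue_def cong_def del: One_nat_def)
    done
qed

lemma mod_progression: "q dvd A \<Longrightarrow> (A * m + B) mod q = B mod (q :: nat)"
  by (auto elim!: dvdE simp: mult.assoc)

text \<open>Even digits give the factor 2, digit 5 the factor 5, and digits 1 and 7 the factor 3.
  Digits 3 and 9 use the coverings after appended zeros.\<close>

lemma all_translated_unit_sensitive_progression:
  "all_translated_unit_sensitive (progression_modulus * m + progression_residue)"
proof -
  let ?p = "progression_modulus * m + progression_residue"
  \<comment> \<open>Without appended zeros, digit 3 gives \<open>?p\<close> itself, and digit 9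
    gives \<open>?p + 6\<close>, a multiple of 7 because \<open>?p\<close> is 1 modulo 7.\<close>
  have mods: "?p mod 10 = 3" "?p mod 3 = 2" "?p mod 7 = 1"
    by (subst mod_progression; simp add: progression_modulus_def progression_residue_def)+
  have large: "?p > 100" by (simp add: progression_residue_def)
  have digits: "j = 0 \<or> j = 1 \<or> j = 2 \<or> j = 3 \<or> j = 4 \<or> j = 5 \<or> j = 6 \<or> j = 7 \<or> j = 8 \<or> j = 9"
    if "j \<in> {0..9}" for j :: nat
    using that unfolding atLeastAtMost_iff by presburger
  have unit_digit: "composite (10 * (?p div 10) + j)"
    if j: "j \<in> {0..9}" "10 * (?p div 10) + j \<noteq> ?p" for j
  proof -
    define w where "w = ?p div 10"
    have w: "?p = 10 * w + 3" using mods(1) unfolding w_def by presburger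
    have 3: "3 dvd 10 * w + 1" "3 dvd 10 * w + 7" using mods(2) unfolding w by presburger+
    have 7: "7 dvd 10 * w + 9" using mods(3) unfolding w by presburger
    have "w > 1" using large unfolding w by simp
    have "j \<noteq> 3" using j(2) unfolding w_def [symmetric] w by simp
    have small: "composite (10 * w + j)" if "q dvd 10 * w + j" "1 < q" "q < 10" for q
      using that \<open>w > 1\<close> by (intro compositeI[of q]) auto
    have 2: "2 dvd 10 * w" and 5: "5 dvd 10 * w" by simp_all
    from digits[OF j(1)] have "composite (10 * w + j)"
    proof (elim disjE)
      assume "j = 1" thus "composite (10 * w + j)" using small[of 3] 3 by simp
    next
      assume "j = 7" thus "composite (10 * w + j)" using small[of 3] 3 by simp
    next
      assume "j = 9" thus "composite (10 * w + j)" using small[of 7] 7 by simp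
    next
      assume "j = 5" thus "composite (10 * w + j)" using small[of 5] 5 by simp
    next
      assume "j = 3" thus "composite (10 * w + j)" using \<open>j \<noteq> 3\<close> by simp
    qed (use small[of 2] 2 in simp)+
    thus ?thesis by (simp add: w_def)
  qed
  have appended: "composite (10 ^ d * ?p + j)" if d: "d \<noteq> 0" and j: "j \<in> {0..9}" for d j
  proof -
    have small: "composite (10 ^ d * ?p + j)" if "q dvd 10 ^ d * ?p + j" "1 < q" "q < 10" for q
    proof (rule compositeI[OF that(1,2)])
      have "1 * 100 \<le> 10 ^ d * ?p" using large by (intro mult_mono) auto
      thus "q < 10 ^ d * ?p + j" using that by simp
    qed
    have 10: "10 dvd 10 ^ d * ?p" using d by (simp add: dvd_power)
    have 2: "2 dvd 10 ^ d * ?p" and 5: "5 dvd 10 ^ d * ?p"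
      using dvd_trans[OF _ 10, of 2] dvd_trans[OF _ 10, of 5] by simp_all
    \<comment> \<open>Powers of 10 are 1 modulo 3, hence the period 1.\<close>
    have 3: "3 dvd 10 ^ d * ?p + 1" "3 dvd 10 ^ d * ?p + 7"
      by (rule dvd_power_10_progression[where T = 1 and r = 0]; simp add: progression_modulus_def progression_residue_def cong_def)+
    from digits[OF j] show ?thesis
    proof (elim disjE)
      assume "j = 3" thus ?thesis using composite_ending_3 by simp
    next
      assume "j = 9" thus ?thesis using composite_ending_9 by simp
    next
      assume "j = 1" thus ?thesis using small[of 3] 3 by simp
    next
      assume "j = 7" thus ?thesis using small[of 3] 3 by simp
    next
      assume "j = 5" thus ?thesis using small[of 5] 5 by simp
    qed (use small[of 2] 2 in simp)+
  qed
  show ?thesis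
    unfolding all_translated_unit_sensitive_def translated_unit_sensitive_def
  proof (intro allI conjI)
    fix d
    show "?p > 0" using large by linarith
    show "if d = 0 then \<forall>j\<in>{0..9}. 10 * (?p div 10) + j \<noteq> ?p \<longrightarrow> composite (10 * (?p div 10) + j)
          else \<forall>j\<in>{0..9}. composite (10 ^ d * ?p + j)"
    proof (cases "d = 0")
      case True
      show ?thesis unfolding if_P[OF True] by (intro ballI impI unit_digit)
    next
      case False
      show ?thesis unfolding if_not_P[OF False] by (intro ballI appended False)
    qed
  qed
qed

section \<open>Infinitely many primes in the chosen progression\<close>

lemma coprime_bezout:
  assumes "B * x = A * y + (1 :: nat)"
  shows "coprime B A"
proof (rule coprimeI)
  fix c assume c: "c dvd B" "c dvd A"
  hence "c dvd A * y + 1" unfolding assms [symmetric] by (intro dvd_mult2)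
  thus "is_unit c" using c(2) dvd_add_right_iff[of c "A * y" 1] by simp
qed

theorem theorem1:
  shows "infinite {p :: nat. prime p \<and> all_translated_unit_sensitive p} \<and>
    infinite {p :: nat. prime p \<and> (\<exists>m :: nat.
        p = 124703827160493827160493827160493827160493827160493827035790 * m
          + 41459060189171787548442999328384678040412832671445258454633) \<and>
      all_translated_unit_sensitive p}"
proof -
  let ?S = "{p. prime p \<and> (\<exists>m. p = progression_modulus * m + progression_residue) \<and> all_translated_unit_sensitive p}"
  have "coprime progression_residue progression_modulus"
    \<comment> \<open>The witnesses are Bezout coefficients: \<open>x\<close> inverts the residue
      modulo the modulus, and evaluating one identity certifies coprimality.\<close>
    by (rule coprime_bezout
         [where x = 75505282923562514027970203740982167597710205439924281442297
            and y = 25102501988969644109832016512224531070569374754878355042800])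
       (simp add: progression_modulus_def progression_residue_def)
  moreover have "progression_modulus > 0" by (simp add: progression_modulus_def)
  \<comment> \<open>Discarding the finitely many primes below the residue lets the congruence be
    written with a nonnegative multiple of the modulus.\<close>
  ultimately have "infinite ({p. prime p \<and> [p = progression_residue] (mod progression_modulus)} - {..<progression_residue})"
    by (intro Diff_infinite_finite dirichlet_primes_in_progression) auto
  moreover have "{p. prime p \<and> [p = progression_residue] (mod progression_modulus)} - {..<progression_residue} \<subseteq> ?S"
  proof
    fix p assume p: "p \<in> {p. prime p \<and> [p = progression_residue] (mod progression_modulus)} - {..<progression_residue}"
    hence "\<exists>m. p = m * progression_modulus + progression_residue" using cong_le_nat[of progression_residue p progression_modulus] by auto
    then obtain m where "p = progression_modulus * m + progression_residue" by (metis mult.commute)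
    thus "p \<in> ?S" using p all_translated_unit_sensitive_progression[of m] by blast
  qed
  ultimately have inf: "infinite ?S" using infinite_super by blast
  moreover have "?S \<subseteq> {p. prime p \<and> all_translated_unit_sensitive p}" by blast
  ultimately have "infinite {p :: nat. prime p \<and> all_translated_unit_sensitive p}"
    using infinite_super by blast
  with inf show ?thesis unfolding progression_modulus_def progression_residue_def by blast
qed

end
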